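(* For $i=1,2$, the spaces $\mathrm{H}^2_{\rm diff}(\mathfrak{vect}(1),\mathcal{D}_{a_i,a_i+9})$, $\mathrm{H}^2_{\rm diff}(\mathfrak{vect}(1),\mathcal{D}_{a_i-3,a_i+6})$, $\mathrm{H}^2_{\rm diff}(\mathfrak{vect}(1),\mathcal{D}_{-8,1})$, $\mathrm{H}^2_{\rm diff}(\mathfrak{vect}(1),\mathcal{D}_{0,9})$, $\mathrm{H}^2_{\rm diff}(\mathfrak{vect}(1),\mathcal{D}_{-4,5})$, $\mathrm{H}^2_{\rm diff}(\mathfrak{vect}(1),\mathcal{D}_{a_i,a_i+10})$, $\mathrm{H}^2_{\rm diff}(\mathfrak{vect}(1),\mathcal{D}_{a_i-4,a_i+6})$ are respectively spanned by the cohomology classes of the following nontrivial 2-cocycles: $$\begin{array}{ll} \Omega_{a_i,a_i+9}=[\![C_{a_i+6,a_i+9},C_{a_i,a_i+6}]\!],&\Omega_{a_i-3,a_i+6}=[\![C_{a_i,a_i+6},C_{a_i-3,a_i}]\!],\\ \Omega_{-8,1}=[\![C_{-4,1},C_{-8,-4}]\!],&\Omega_{0,9}=[\![C_{5,9},C_{0,5}]\!],\\ \Omega_{-4,5}=[\![C_{1,5},C_{-4,1}]\!],&\Omega_{a_i,a_i+10}=[\![C_{a_i+6,a_i+10},C_{a_i,a_i+6}]\!],\\ \Omega_{a_i-4,a_i+6}=[\![C_{a_i,a_i+6},C_{a_i-4,a_i}]\!].& \end{array}$$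
   Context: $\mathfrak{vect}(1)$ is the Lie algebra of polynomial vector fields $X\frac{d}{dx}$, $X\in\mathbb{R}[x]$. $\mathcal{F}_\lambda=\{f\,dx^\lambda: f\in\mathbb{R}[x]\}$ with action $L^\lambda_X(f)=Xf'+\lambda X'f$. $\mathcal{D}_{\nu,\mu}$ is the $\mathfrak{vect}(1)$-module of linear differential operators $\mathcal{F}_\nu\to\mathcal{F}_\mu$, with action $L^{\nu,\mu}_X(A)=L^\mu_X\circ A-A\circ L^\nu_X$. $\mathrm{H}^i_{\rm diff}$ denotes differential cohomology: only cochains given by differential operators are considered. A cocycle is nontrivial if it is not a coboundary. 1-cocycles $C_{\lambda,\lambda+k}:\mathfrak{vect}(1)\to\mathcal{D}_{\lambda,\lambda+k}$: - $C_{\lambda,\lambda+3}(X)(f)=X^{(3)}f'+X''f''$ (all $\lambda$); - $C_{\lambda,\lambda+4}(X)(f)=-\lambda X^{(5)}f+X^{(4)}f'-6X^{(3)}f''-4X''f^{(3)}$ (all $\lambda$); - $C_{0,5}(X)(f)=2X^{(5)}f'-5X^{(4)}f''+10X^{(3)}f^{(3)}+5X''f^{(4)}$; - $C_{-4,1}(X)(f)=12X^{(6)}f+22X^{(5)}f'+5X^{(4)}f''-10X^{(3)}f^{(3)}-5X''f^{(4)}$; - $C_{a_i,a_i+6}(X)(f)=\alpha_iX^{(7)}f-\beta_iX^{(6)}f'-\gamma_iX^{(5)}f''-5X^{(4)}f^{(3)}+5X^{(3)}f^{(4)}+2X''f^{(5)}$, where $a_1=-\frac{5+\sqrt{19}}2$,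 $\alpha_1=-\frac{22+5\sqrt{19}}4$, $\beta_1=\frac{31+7\sqrt{19}}2$, $\gamma_1=\frac{25+7\sqrt{19}}2$, and $a_2,\alpha_2,\beta_2,\gamma_2$ are obtained by replacing $\sqrt{19}$ by $-\sqrt{19}$. Cup-product: for linear maps $C_1,C_2:\mathfrak g\to\mathrm{End}(V)$, $[\![C_1,C_2]\!](X,Y)=[C_1(X),C_2(Y)]+[C_2(X),C_1(Y)]$. For $C_1$ with values in $\mathcal{D}_{\mu,\rho}$ and $C_2$ with values in $\mathcal{D}_{\nu,\mu}$ (with $\nu<\mu<\rho$; extend by $0$ to the direct sum of the density modules) this is $[\![C_1,C_2]\!](X,Y)=C_1(X)\circ C_2(Y)-C_1(Y)\circ C_2(X)\in\mathcal{D}_{\nu,\rho}$. *)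

theory Defs
  imports
    Complex_Main
    "HOL-Computational_Algebra.Polynomial"
    "HOL-Library.Function_Algebras"
begin

text \<open>
  A polynomial \<open>X\<close> stands for the vector field \<open>X d/dx\<close>, and a polynomial \<open>f\<close> also stands for
  the density \<open>f dx^l\<close> of whatever weight \<open>l\<close> is meant: the weight is never part of the object,
  it only enters through the action. Operators and cochains are functions, added
  and subtracted pointwise.
\<close>

type_synonym vfield = "real poly"
type_synonym dens = "real poly"
type_synonym oper = "dens \<Rightarrow> dens"
type_synonym cochain1 = "vfield \<Rightarrow> oper"
type_synonym cochain2 = "vfield \<Rightarrow> vfield \<Rightarrow> oper"

abbreviation dx :: "nat \<Rightarrow> real poly \<Rightarrow> real poly" where
  "dx n \<equiv> pderiv ^^ n"

definition vbracket :: "vfield \<Rightarrow> vfield \<Rightarrow> vfield" where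
  "vbracket X Y = X * pderiv Y - pderiv X * Y"

definition Lie_dens :: "real \<Rightarrow> vfield \<Rightarrow> oper" where
  "Lie_dens l X f = X * pderiv f + smult l (pderiv X * f)"

lemma Lie_dens_vbracket:
  "Lie_dens l (vbracket X Y) = (Lie_dens l X \<circ> Lie_dens l Y) - (Lie_dens l Y \<circ> Lie_dens l X)"
  by (rule ext)
    (simp add: Lie_dens_def vbracket_def pderiv_mult pderiv_add pderiv_diff pderiv_smult
      algebra_simps smult_add_right smult_diff_right)

definition Lie_oper :: "real \<Rightarrow> real \<Rightarrow> vfield \<Rightarrow> oper \<Rightarrow> oper" where
  "Lie_oper \<nu> \<mu> X A = (Lie_dens \<mu> X \<circ> A) - (A \<circ> Lie_dens \<nu> X)"

subsection \<open>Differential cochains\<close>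

text \<open>
  Differential cochains are polydifferential operators with polynomial coefficients. In
  particular their values are linear differential operators between densities, so no separate
  condition on the values is needed, and linearity in each argument is automatic as well.
\<close>

definition diff_cochains1 :: "cochain1 set" where
  "diff_cochains1 = {b. \<exists>(n::nat) (p :: nat \<Rightarrow> nat \<Rightarrow> real poly). \<forall>X f.
     b X f = (\<Sum>i\<le>n. \<Sum>k\<le>n. p i k * dx i X * dx k f)}"

definition diff_cochains2 :: "cochain2 set" where
  "diff_cochains2 = {c. (\<exists>(n::nat) (p :: nat \<Rightarrow> nat \<Rightarrow> nat \<Rightarrow> real poly). \<forall>X Y f.
     c X Y f = (\<Sum>i\<le>n. \<Sum>j\<le>n. \<Sum>k\<le>n. p i j k * dx i X * dx j Y * dx k f))
     \<and> (\<forall>X Y. c Y X = - c X Y)}"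

text \<open>Chevalley--Eilenberg differentials in degrees 1 and 2 with coefficients in the module of
  operators from densities of weight \<open>\<nu>\<close> to densities of weight \<open>\<mu>\<close>.\<close>

definition delta1 :: "real \<Rightarrow> real \<Rightarrow> cochain1 \<Rightarrow> cochain2" where
  "delta1 \<nu> \<mu> b X Y =
     Lie_oper \<nu> \<mu> X (b Y) - Lie_oper \<nu> \<mu> Y (b X) - b (vbracket X Y)"

definition delta2 :: "real \<Rightarrow> real \<Rightarrow> cochain2 \<Rightarrow> vfield \<Rightarrow> vfield \<Rightarrow> vfield \<Rightarrow> oper" where
  "delta2 \<nu> \<mu> c X Y Z =
     Lie_oper \<nu> \<mu> X (c Y Z) - Lie_oper \<nu> \<mu> Y (c X Z) + Lie_oper \<nu> \<mu> Z (c X Y)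
     - c (vbracket X Y) Z + c (vbracket X Z) Y - c (vbracket Y Z) X"

definition cocycles2 :: "real \<Rightarrow> real \<Rightarrow> cochain2 set" where
  "cocycles2 \<nu> \<mu> = {c \<in> diff_cochains2. \<forall>X Y Z. delta2 \<nu> \<mu> c X Y Z = 0}"

definition coboundaries2 :: "real \<Rightarrow> real \<Rightarrow> cochain2 set" where
  "coboundaries2 \<nu> \<mu> = delta1 \<nu> \<mu> ` diff_cochains1"

definition nontrivial_cocycle2 :: "real \<Rightarrow> real \<Rightarrow> cochain2 \<Rightarrow> bool" where
  "nontrivial_cocycle2 \<nu> \<mu> c \<longleftrightarrow> c \<in> cocycles2 \<nu> \<mu> \<and> c \<notin> coboundaries2 \<nu> \<mu>"

subsection \<open>The second differential cohomology space\<close>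

definition cohomologous :: "real \<Rightarrow> real \<Rightarrow> (cochain2 \<times> cochain2) set" where
  "cohomologous \<nu> \<mu> =
     {(c, c'). c \<in> cocycles2 \<nu> \<mu> \<and> c' \<in> cocycles2 \<nu> \<mu> \<and> c - c' \<in> coboundaries2 \<nu> \<mu>}"

definition H2 :: "real \<Rightarrow> real \<Rightarrow> cochain2 set set" where
  "H2 \<nu> \<mu> = cocycles2 \<nu> \<mu> // cohomologous \<nu> \<mu>"

definition coh_class :: "real \<Rightarrow> real \<Rightarrow> cochain2 \<Rightarrow> cochain2 set" where
  "coh_class \<nu> \<mu> c = cohomologous \<nu> \<mu> `` {c}"

definition scale_cochain2 :: "real \<Rightarrow> cochain2 \<Rightarrow> cochain2" where
  "scale_cochain2 t c = (\<lambda>X Y f. smult t (c X Y f))"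

text \<open>The vector space operations of the quotient, via representatives. The union is over
  equal sets, since the operations respect \<open>cohomologous\<close>.\<close>

definition H2_zero :: "real \<Rightarrow> real \<Rightarrow> cochain2 set" where
  "H2_zero \<nu> \<mu> = coh_class \<nu> \<mu> 0"

definition H2_add :: "real \<Rightarrow> real \<Rightarrow> cochain2 set \<Rightarrow> cochain2 set \<Rightarrow> cochain2 set" where
  "H2_add \<nu> \<mu> K L = (\<Union>c\<in>K. \<Union>c'\<in>L. coh_class \<nu> \<mu> (c + c'))"

definition H2_scale :: "real \<Rightarrow> real \<Rightarrow> real \<Rightarrow> cochain2 set \<Rightarrow> cochain2 set" where
  "H2_scale \<nu> \<mu> t K = (\<Union>c\<in>K. coh_class \<nu> \<mu> (scale_cochain2 t c))"

definition H2_subspace :: "real \<Rightarrow> real \<Rightarrow> cochain2 set set \<Rightarrow> bool" where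
  "H2_subspace \<nu> \<mu> W \<longleftrightarrow> W \<subseteq> H2 \<nu> \<mu> \<and> H2_zero \<nu> \<mu> \<in> W
     \<and> (\<forall>K\<in>W. \<forall>L\<in>W. H2_add \<nu> \<mu> K L \<in> W) \<and> (\<forall>t. \<forall>K\<in>W. H2_scale \<nu> \<mu> t K \<in> W)"

definition H2_span :: "real \<Rightarrow> real \<Rightarrow> cochain2 set set \<Rightarrow> cochain2 set set" where
  "H2_span \<nu> \<mu> S = \<Inter>{W. H2_subspace \<nu> \<mu> W \<and> S \<subseteq> W}"

definition H2_spanned_by_nontrivial :: "real \<Rightarrow> real \<Rightarrow> cochain2 \<Rightarrow> bool" where
  "H2_spanned_by_nontrivial \<nu> \<mu> c \<longleftrightarrow>
     nontrivial_cocycle2 \<nu> \<mu> c \<and> H2 \<nu> \<mu> = H2_span \<nu> \<mu> {coh_class \<nu> \<mu> c}"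

subsection \<open>The 1-cocycles and their cup-products\<close>

text \<open>For \<open>C1\<close> with values in operators from weight \<open>\<mu>\<close> to \<open>\<rho>\<close> and \<open>C2\<close> with values in
  operators from \<open>\<nu>\<close> to \<open>\<mu>\<close>, \<open>\<nu> < \<mu> < \<rho>\<close>: the other two terms of
  \<open>[C1 X, C2 Y] + [C2 X, C1 Y]\<close> vanish on the direct sum of the density modules.\<close>

definition cup :: "cochain1 \<Rightarrow> cochain1 \<Rightarrow> cochain2" where
  "cup C1 C2 X Y = (C1 X \<circ> C2 Y) - (C1 Y \<circ> C2 X)"

text \<open>\<open>C3 l\<close> has values in operators from weight \<open>l\<close> to \<open>l + 3\<close>, and its formula does not
  depend on \<open>l\<close>; \<open>C4 l\<close> is the analogue from \<open>l\<close> to \<open>l + 4\<close>.\<close>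

definition C3 :: "real \<Rightarrow> cochain1" where
  "C3 l X f = dx 3 X * dx 1 f + dx 2 X * dx 2 f"

definition C4 :: "real \<Rightarrow> cochain1" where
  "C4 l X f = - smult l (dx 5 X * f) + dx 4 X * dx 1 f - 6 * dx 3 X * dx 2 f - 4 * dx 2 X * dx 3 f"

definition C_0_5 :: cochain1 where
  "C_0_5 X f = 2 * dx 5 X * dx 1 f - 5 * dx 4 X * dx 2 f + 10 * dx 3 X * dx 3 f
     + 5 * dx 2 X * dx 4 f"

definition C_m4_1 :: cochain1 where
  "C_m4_1 X f = 12 * dx 6 X * f + 22 * dx 5 X * dx 1 f + 5 * dx 4 X * dx 2 f
     - 10 * dx 3 X * dx 3 f - 5 * dx 2 X * dx 4 f"

definition sqrt19 :: "nat \<Rightarrow> real" where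
  "sqrt19 i = (if i = 1 then sqrt 19 else - sqrt 19)"

definition wt_a :: "nat \<Rightarrow> real" where
  "wt_a i = - (5 + sqrt19 i) / 2"

definition coef_alpha :: "nat \<Rightarrow> real" where
  "coef_alpha i = - (22 + 5 * sqrt19 i) / 4"

definition coef_beta :: "nat \<Rightarrow> real" where
  "coef_beta i = (31 + 7 * sqrt19 i) / 2"

definition coef_gamma :: "nat \<Rightarrow> real" where
  "coef_gamma i = (25 + 7 * sqrt19 i) / 2"

text \<open>From weight \<open>wt_a i\<close> to \<open>wt_a i + 6\<close>, for \<open>i = 1, 2\<close>.\<close>

definition C6 :: "nat \<Rightarrow> cochain1" where
  "C6 i X f = smult (coef_alpha i) (dx 7 X * f) - smult (coef_beta i) (dx 6 X * dx 1 f)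
     - smult (coef_gamma i) (dx 5 X * dx 2 f) - 5 * dx 4 X * dx 3 f + 5 * dx 3 X * dx 4 f
     + 2 * dx 2 X * dx 5 f"

end

(* Subtracting a coboundary (found by integrating coefficients) makes a 2-cocycle vanish on d/dx,
   hence translation invariant, so that it is determined by its values on monomials at the origin.
   The Euler field x d/dx acts on these by their weight, and the Cartan formula kills every weight
   except zero. What remains is the finite-dimensional weight-zero complex, where a cocycle is an
   antisymmetric array z(i,j) with i + j <= d + 2, for d the difference of the two weights.
   For d = 9 and d = 10 and all but finitely many source weights nu, one can normalise
   z(1,3) = z(3,4) = 0 and z(2,j) = 0 for j >= 3 by coboundaries, and the cocycle equations then
   express all of z as multiples of z(4,5). So H^2 is at most one-dimensional. Nontriviality of a
   cup-product is decided by the linear functional which vanishes on coboundaries and is a nonzero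
   multiple of z(4,5) on normalised arrays. The weights a_i enter only through
   2 a^2 + 10 a + 3 = 0. *)
theory Submission
  imports Defs
begin

text \<open>How much freedom a weight-zero 1-cochain b(1), ..., b(d+1) leaves decides which entries
  can be normalised. In the entry (2,j) of its coboundary b(j+1) has coefficient 2 - j, so for j >=
  3 these entries determine b(4), b(5), ... from b(2) and b(3); b(1) enters only entries with an
  index 1. The array k(1) = 0, k(j) = d + 1 - j + nu j for j >= 2 is, up to sign, the coboundary of
  the d-th derivative, hence lies in the kernel of \<open>wt_cob\<close>; so b(3) = 0 is no loss
  when k(3) = d - 2 + 3 nu is nonzero. What remains is b(2), which the entry (3,4) fixes when the
  cubic \<open>pivot_coeff\<close> in nu is nonzero. The same two conditions serve index 1: the
  coefficient of b(1) in the entry (1,3) is again d - 2 + 3 nu, and a nonzero pivot forces the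
  1-cocycle z(1,j) to vanish once z(1,3) = 0. The equations with an index 2 propagate zeros along
  increasing i + j and first leave an entry free at i + j = 9. At i + j = 11 they leave another one,
  which is killed by the equation at (3,4,5), available from d = 9 on.\<close>

section \<open>Linearity of the action; the differentials on arguments\<close>

lemma Lie_dens_add: "Lie_dens l X (f + g) = Lie_dens l X f + Lie_dens l X g"
  by (simp add: Lie_dens_def pderiv_add algebra_simps smult_add_right)

lemma Lie_dens_smult: "Lie_dens l X (smult t f) = smult t (Lie_dens l X f)"
  by (simp add: Lie_dens_def pderiv_smult algebra_simps smult_add_right)

lemma Lie_dens_0 [simp]: "Lie_dens l X 0 = 0"
  by (simp add: Lie_dens_def)

lemma Lie_dens_minus: "Lie_dens l X (- f) = - Lie_dens l X f"
  using Lie_dens_smult[of l X "-1" f] by simp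

lemma Lie_dens_diff: "Lie_dens l X (f - g) = Lie_dens l X f - Lie_dens l X g"
  by (metis (no_types) Lie_dens_add Lie_dens_minus diff_conv_add_uminus)

lemma delta1_apply:
  "delta1 \<nu> \<mu> b X Y f = Lie_dens \<mu> X (b Y f) - b Y (Lie_dens \<nu> X f)
     - (Lie_dens \<mu> Y (b X f) - b X (Lie_dens \<nu> Y f)) - b (vbracket X Y) f"
  by (simp add: delta1_def Lie_oper_def)

lemma delta2_apply:
  "delta2 \<nu> \<mu> c X Y Z f = Lie_dens \<mu> X (c Y Z f) - c Y Z (Lie_dens \<nu> X f)
     - (Lie_dens \<mu> Y (c X Z f) - c X Z (Lie_dens \<nu> Y f))
     + (Lie_dens \<mu> Z (c X Y f) - c X Y (Lie_dens \<nu> Z f))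
     - c (vbracket X Y) Z f + c (vbracket X Z) Y f - c (vbracket Y Z) X f"
  by (simp add: delta2_def Lie_oper_def)

subsection \<open>Polydifferential operators\<close>

text \<open>Antisymmetry is split off because the single summands of a differential or a cup-product
  do not have it.\<close>

definition tridiff :: "cochain2 \<Rightarrow> bool" where
  "tridiff c \<longleftrightarrow> (\<exists>(n::nat) (p :: nat \<Rightarrow> nat \<Rightarrow> nat \<Rightarrow> real poly). \<forall>X Y f.
     c X Y f = (\<Sum>i\<le>n. \<Sum>j\<le>n. \<Sum>k\<le>n. p i j k * dx i X * dx j Y * dx k f))"

lemma diff_cochains2_iff:
  "c \<in> diff_cochains2 \<longleftrightarrow> tridiff c \<and> (\<forall>X Y. c Y X = - c X Y)"
  by (simp add: diff_cochains2_def tridiff_def)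

lemma sum_atMost_extend:
  fixes g :: "nat \<Rightarrow> 'a::comm_monoid_add"
  assumes "n \<le> m"
  shows "(\<Sum>i\<le>m. if i \<le> n then g i else 0) = (\<Sum>i\<le>n. g i)"
proof -
  have "(\<Sum>i\<le>m. if i \<le> n then g i else 0) = (\<Sum>i\<in>{..n}. if i \<le> n then g i else 0)"
    using assms by (intro sum.mono_neutral_right) auto
  then show ?thesis by simp
qed

text \<open>Padding the coefficients with zeros makes the formula valid for every larger bound, so
  that two operators can share one.\<close>

lemma diff_cochains1E:
  assumes "b \<in> diff_cochains1"
  obtains n p where "\<And>m X f. n \<le> m \<Longrightarrow> b X f = (\<Sum>i\<le>m. \<Sum>k\<le>m. p i k * dx i X * dx k f)"
proof -
  obtain n p where p: "\<And>X f. b X f = (\<Sum>i\<le>n. \<Sum>k\<le>n. p i k * dx i X * dx k f)"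
    using assms unfolding diff_cochains1_def by blast
  define q where "q = (\<lambda>i k. if i \<le> n then if k \<le> n then p i k else 0 else 0)"
  have 1: "q i k * u * v = (if i \<le> n then if k \<le> n then p i k * u * v else 0 else 0)" for i k u v
    by (simp add: q_def)
  have 2: "(\<Sum>k\<in>A. if P then g k else 0) = (if P then (\<Sum>k\<in>A. g k) else (0::real poly))" for A :: "nat set" and P g
    by simp
  have "b X f = (\<Sum>i\<le>m. \<Sum>k\<le>m. q i k * dx i X * dx k f)" if "n \<le> m" for m X f
    unfolding 1 2 sum_atMost_extend[OF that] p ..
  then show ?thesis using that by blast
qed

lemma tridiffE:
  assumes "tridiff c"
  obtains n p where "\<And>m X Y f. n \<le> m \<Longrightarrow>
      c X Y f = (\<Sum>i\<le>m. \<Sum>j\<le>m. \<Sum>k\<le>m. p i j k * dx i X * dx j Y * dx k f)"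
proof -
  obtain n p where p: "\<And>X Y f. c X Y f = (\<Sum>i\<le>n. \<Sum>j\<le>n. \<Sum>k\<le>n. p i j k * dx i X * dx j Y * dx k f)"
    using assms unfolding tridiff_def by blast
  define q where "q = (\<lambda>i j k. if i \<le> n then if j \<le> n then if k \<le> n then p i j k else 0 else 0 else 0)"
  have 1: "q i j k * u * v * w =
      (if i \<le> n then if j \<le> n then if k \<le> n then p i j k * u * v * w else 0 else 0 else 0)" for i j k u v w
    by (simp add: q_def)
  have 2: "(\<Sum>k\<in>A. if P then g k else 0) = (if P then (\<Sum>k\<in>A. g k) else (0::real poly))" for A :: "nat set" and P g
    by simp
  have "c X Y f = (\<Sum>i\<le>m. \<Sum>j\<le>m. \<Sum>k\<le>m. q i j k * dx i X * dx j Y * dx k f)" if "n \<le> m" for m X Y f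
    unfolding 1 2 sum_atMost_extend[OF that] p ..
  then show ?thesis using that by blast
qed

lemma diff_cochains1_add:
  assumes "b \<in> diff_cochains1" "b' \<in> diff_cochains1"
  shows "(\<lambda>X f. b X f + b' X f) \<in> diff_cochains1"
proof -
  obtain n p where p: "\<And>m X f. n \<le> m \<Longrightarrow> b X f = (\<Sum>i\<le>m. \<Sum>k\<le>m. p i k * dx i X * dx k f)"
    by (rule diff_cochains1E[OF assms(1)]) blast
  obtain n' p' where p': "\<And>m X f. n' \<le> m \<Longrightarrow> b' X f = (\<Sum>i\<le>m. \<Sum>k\<le>m. p' i k * dx i X * dx k f)"
    by (rule diff_cochains1E[OF assms(2)]) blast
  have "b X f + b' X f = (\<Sum>i\<le>max n n'. \<Sum>k\<le>max n n'. (p i k + p' i k) * dx i X * dx k f)" for X f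
    unfolding p[OF max.cobounded1[of n n']] p'[OF max.cobounded2[of n' n]]
    by (simp only: sum.distrib distrib_right)
  then show ?thesis unfolding diff_cochains1_def
    by (intro CollectI exI[of _ "max n n'"] exI[of _ "\<lambda>i k. p i k + p' i k"]) blast
qed

lemma tridiff_add:
  assumes "tridiff c" "tridiff c'"
  shows "tridiff (\<lambda>X Y f. c X Y f + c' X Y f)"
proof -
  obtain n p where p: "\<And>m X Y f. n \<le> m \<Longrightarrow>
      c X Y f = (\<Sum>i\<le>m. \<Sum>j\<le>m. \<Sum>k\<le>m. p i j k * dx i X * dx j Y * dx k f)"
    by (rule tridiffE[OF assms(1)]) blast
  obtain n' p' where p': "\<And>m X Y f. n' \<le> m \<Longrightarrow>
      c' X Y f = (\<Sum>i\<le>m. \<Sum>j\<le>m. \<Sum>k\<le>m. p' i j k * dx i X * dx j Y * dx k f)"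
    by (rule tridiffE[OF assms(2)]) blast
  have "c X Y f + c' X Y f = (\<Sum>i\<le>max n n'. \<Sum>j\<le>max n n'. \<Sum>k\<le>max n n'.
      (p i j k + p' i j k) * dx i X * dx j Y * dx k f)" for X Y f
    unfolding p[OF max.cobounded1[of n n']] p'[OF max.cobounded2[of n' n]]
    by (simp only: sum.distrib distrib_right)
  then show ?thesis unfolding tridiff_def
    by (intro exI[of _ "max n n'"] exI[of _ "\<lambda>i j k. p i j k + p' i j k"]) blast
qed

lemma tridiff_mono: "tridiff (\<lambda>X Y f. q * dx i X * dx j Y * dx k f)"
proof -
  define n where "n = max i (max j k)"
  have le: "i \<le> n" "j \<le> n" "k \<le> n" by (auto simp: n_def)
  define p where "p = (\<lambda>i' j' k'. if i' = i then if j' = j then if k' = k then q else 0 else 0 else 0)"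
  have 1: "p i' j' k' * u * v * w =
      (if i' = i then if j' = j then if k' = k then q * u * v * w else 0 else 0 else 0)" for i' j' k' u v w
    by (simp add: p_def)
  have 2: "(\<Sum>k\<in>A. if P then g k else 0) = (if P then (\<Sum>k\<in>A. g k) else (0::real poly))" for A :: "nat set" and P g
    by simp
  have "q * dx i X * dx j Y * dx k f = (\<Sum>i'\<le>n. \<Sum>j'\<le>n. \<Sum>k'\<le>n. p i' j' k' * dx i' X * dx j' Y * dx k' f)" for X Y f
    unfolding 1 2 using le by simp
  then show ?thesis unfolding tridiff_def by blast
qed

lemma diff_cochains1_mono: "(\<lambda>X f. q * dx i X * dx k f) \<in> diff_cochains1"
proof -
  define n where "n = max i k"
  have le: "i \<le> n" "k \<le> n" by (auto simp: n_def)
  define p where "p = (\<lambda>i' k'. if i' = i then if k' = k then q else 0 else 0)"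
  have 1: "p i' k' * u * w = (if i' = i then if k' = k then q * u * w else 0 else 0)" for i' k' u w
    by (simp add: p_def)
  have 2: "(\<Sum>k\<in>A. if P then g k else 0) = (if P then (\<Sum>k\<in>A. g k) else (0::real poly))" for A :: "nat set" and P g
    by simp
  have "q * dx i X * dx k f = (\<Sum>i'\<le>n. \<Sum>k'\<le>n. p i' k' * dx i' X * dx k' f)" for X f
    unfolding 1 2 using le by simp
  then show ?thesis unfolding diff_cochains1_def by blast
qed

lemma diff_cochains1_0: "(\<lambda>X f. 0) \<in> diff_cochains1"
  using diff_cochains1_mono[of 0 0 0] by simp

lemma tridiff_0: "tridiff (\<lambda>X Y f. 0)"
  using tridiff_mono[of 0 0 0 0] by simp

lemma tridiff_sum:
  assumes "finite A" "\<And>a. a \<in> A \<Longrightarrow> tridiff (c a)"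
  shows "tridiff (\<lambda>X Y f. \<Sum>a\<in>A. c a X Y f)"
  using assms by (induction A rule: finite_induct) (simp_all add: tridiff_0 tridiff_add)

text \<open>Reduces closure properties to a single monomial. No case for zero is required: it is the
  monomial with q = 0.\<close>

lemma diff_cochains1_induct [consumes 1, case_names mono add]:
  assumes b: "b \<in> diff_cochains1"
    and mono: "\<And>q i k. P (\<lambda>X f. q * dx i X * dx k f)"
    and add: "\<And>b b'. P b \<Longrightarrow> P b' \<Longrightarrow> P (\<lambda>X f. b X f + b' X f)"
  shows "P b"
proof -
  obtain n p where p: "\<And>X f. b X f = (\<Sum>i\<le>n. \<Sum>k\<le>n. p i k * dx i X * dx k f)"
    using b unfolding diff_cochains1_def by blast
  have zero: "P (\<lambda>X f. 0)" using mono[of 0 0 0] by simp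
  have sum: "P (\<lambda>X f. \<Sum>a\<in>A. g a X f)" if "finite A" "\<And>a. P (g a)" for A :: "nat set" and g
    using that by (induction A rule: finite_induct) (simp_all add: zero add)
  have "P (\<lambda>X f. \<Sum>i\<le>n. \<Sum>k\<le>n. p i k * dx i X * dx k f)"
    by (intro sum mono finite_atMost)
  moreover have "b = (\<lambda>X f. \<Sum>i\<le>n. \<Sum>k\<le>n. p i k * dx i X * dx k f)"
    by (intro ext) (rule p)
  ultimately show ?thesis by simp
qed

lemma tridiff_induct [consumes 1, case_names mono add]:
  assumes c: "tridiff c"
    and mono: "\<And>q i j k. P (\<lambda>X Y f. q * dx i X * dx j Y * dx k f)"
    and add: "\<And>c c'. P c \<Longrightarrow> P c' \<Longrightarrow> P (\<lambda>X Y f. c X Y f + c' X Y f)"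
  shows "P c"
proof -
  obtain n p where p: "\<And>X Y f. c X Y f = (\<Sum>i\<le>n. \<Sum>j\<le>n. \<Sum>k\<le>n. p i j k * dx i X * dx j Y * dx k f)"
    using c unfolding tridiff_def by blast
  have zero: "P (\<lambda>X Y f. 0)" using mono[of 0 0 0] by simp
  have sum: "P (\<lambda>X Y f. \<Sum>a\<in>A. g a X Y f)" if "finite A" "\<And>a. P (g a)" for A :: "nat set" and g
    using that by (induction A rule: finite_induct) (simp_all add: zero add)
  have "P (\<lambda>X Y f. \<Sum>i\<le>n. \<Sum>j\<le>n. \<Sum>k\<le>n. p i j k * dx i X * dx j Y * dx k f)"
    by (intro sum mono finite_atMost)
  moreover have "c = (\<lambda>X Y f. \<Sum>i\<le>n. \<Sum>j\<le>n. \<Sum>k\<le>n. p i j k * dx i X * dx j Y * dx k f)"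
    by (intro ext) (rule p)
  ultimately show ?thesis by simp
qed


lemma diff_cochains1_scale:
  assumes "b \<in> diff_cochains1"
  shows "(\<lambda>X f. smult t (b X f)) \<in> diff_cochains1"
  using assms
proof (induction b rule: diff_cochains1_induct)
  case (mono q i k)
  show ?case using diff_cochains1_mono[of "smult t q" i k] by simp
next
  case (add b b')
  then show ?case by (simp add: smult_add_right diff_cochains1_add)
qed

lemma diff_cochains1_pderiv:
  assumes "b \<in> diff_cochains1"
  shows "(\<lambda>X f. pderiv (b X f)) \<in> diff_cochains1"
  using assms
proof (induction b rule: diff_cochains1_induct)
  case (mono q i k)
  have "(\<lambda>X f. pderiv (q * dx i X * dx k f)) = (\<lambda>X f. pderiv q * dx i X * dx k f
      + (q * dx (Suc i) X * dx k f + q * dx i X * dx (Suc k) f))"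
    by (intro ext) (simp add: pderiv_mult algebra_simps)
  then show ?case by (simp only: diff_cochains1_add diff_cochains1_mono)
next
  case (add b b')
  then show ?case by (simp add: pderiv_add diff_cochains1_add)
qed

lemma diff_cochains1_dx:
  assumes "b \<in> diff_cochains1"
  shows "(\<lambda>X f. dx n (b X f)) \<in> diff_cochains1"
  using assms by (induction n) (simp_all add: diff_cochains1_pderiv)

lemma tridiff_scale:
  assumes "tridiff c"
  shows "tridiff (\<lambda>X Y f. smult t (c X Y f))"
  using assms
proof (induction c rule: tridiff_induct)
  case (mono q i j k)
  show ?case using tridiff_mono[of "smult t q" i j k] by simp
next
  case (add b b')
  then show ?case by (simp add: smult_add_right tridiff_add)
qed

lemma tridiff_swap:
  assumes "tridiff c"
  shows "tridiff (\<lambda>X Y f. c Y X f)"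
  using assms
proof (induction c rule: tridiff_induct)
  case (mono q i j k)
  show ?case using tridiff_mono[of q j i k] by (simp add: mult_ac)
next
  case (add b b')
  then show ?case by (simp add: tridiff_add)
qed

lemma tridiff_mult_dx:
  assumes "b \<in> diff_cochains1"
  shows "tridiff (\<lambda>X Y f. q * dx i X * b Y f)"
  using assms
proof (induction b rule: diff_cochains1_induct)
  case (mono r j l)
  show ?case using tridiff_mono[of "q * r" i j l] by (simp add: mult_ac)
next
  case (add b b')
  then show ?case by (simp add: distrib_left tridiff_add)
qed

lemma tridiff_comp:
  assumes "b \<in> diff_cochains1" "b' \<in> diff_cochains1"
  shows "tridiff (\<lambda>X Y f. b X (b' Y f))"
  using assms(1)
proof (induction b rule: diff_cochains1_induct)
  case (mono q i k)
  show ?case by (rule tridiff_mult_dx[OF diff_cochains1_dx[OF assms(2)]])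
next
  case (add b b')
  then show ?case by (simp add: tridiff_add)
qed

lemma tridiff_Lie:
  assumes "b \<in> diff_cochains1"
  shows "tridiff (\<lambda>X Y f. Lie_dens \<mu> X (b Y f))"
proof -
  have "tridiff (\<lambda>X Y f. 1 * dx 0 X * pderiv (b Y f))" "tridiff (\<lambda>X Y f. [:\<mu>:] * dx 1 X * b Y f)"
    by (intro tridiff_mult_dx diff_cochains1_pderiv assms)+
  from tridiff_add[OF this] show ?thesis by (simp add: Lie_dens_def)
qed

lemma tridiff_comp_Lie:
  assumes "b \<in> diff_cochains1"
  shows "tridiff (\<lambda>X Y f. b Y (Lie_dens \<nu> X f))"
proof -
  have "(\<lambda>X f. 1 * dx 0 X * dx 1 f + [:\<nu>:] * dx 1 X * dx 0 f) \<in> diff_cochains1"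
    by (intro diff_cochains1_add diff_cochains1_mono)
  moreover have "Lie_dens \<nu> = (\<lambda>X f. 1 * dx 0 X * dx 1 f + [:\<nu>:] * dx 1 X * dx 0 f)"
    by (intro ext) (simp add: Lie_dens_def)
  ultimately have "Lie_dens \<nu> \<in> diff_cochains1" by simp
  from tridiff_swap[OF tridiff_comp[OF assms this]] show ?thesis .
qed

text \<open>Vector fields and densities have the same type, so the bracket itself counts as a
  1-cochain and closure under derivatives applies to it.\<close>

lemma dx_vbracket_sum:
  "\<exists>N (p :: nat \<Rightarrow> nat \<Rightarrow> real poly). \<forall>X Y. dx n (vbracket X Y) = (\<Sum>i\<le>N. \<Sum>j\<le>N. p i j * dx i X * dx j Y)"
proof -
  have "(\<lambda>X Y. 1 * dx 0 X * dx 1 Y + (-1) * dx 1 X * dx 0 Y) \<in> diff_cochains1"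
    by (intro diff_cochains1_add diff_cochains1_mono)
  moreover have "vbracket = (\<lambda>X Y. 1 * dx 0 X * dx 1 Y + (-1) * dx 1 X * dx 0 Y)"
    by (intro ext) (simp add: vbracket_def)
  ultimately have "(\<lambda>X Y. vbracket X Y) \<in> diff_cochains1" by simp
  from diff_cochains1_dx[OF this, of n] show ?thesis
    unfolding diff_cochains1_def by blast
qed

lemma tridiff_vbracket:
  assumes "b \<in> diff_cochains1"
  shows "tridiff (\<lambda>X Y f. b (vbracket X Y) f)"
  using assms
proof (induction b rule: diff_cochains1_induct)
  case (mono q n k)
  obtain N p where "\<And>X Y. dx n (vbracket X Y) = (\<Sum>i\<le>N. \<Sum>j\<le>(N::nat). p i j * dx i X * dx j Y)"
    using dx_vbracket_sum by blast
  then have "(\<lambda>X Y f. q * dx n (vbracket X Y) * dx k f)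
      = (\<lambda>X Y f. \<Sum>i\<le>N. \<Sum>j\<le>N. (q * p i j) * dx i X * dx j Y * dx k f)"
    by (intro ext) (simp add: sum_distrib_left sum_distrib_right mult_ac)
  then show ?case by (simp only: tridiff_sum tridiff_mono finite_atMost)
next
  case (add b b')
  then show ?case by (simp add: tridiff_add)
qed

lemma tridiff_minus: "tridiff c \<Longrightarrow> tridiff (\<lambda>X Y f. - c X Y f)"
  using tridiff_scale[of c "-1"] by simp

lemma tridiff_diff:
  assumes "tridiff c" "tridiff c'"
  shows "tridiff (\<lambda>X Y f. c X Y f - c' X Y f)"
  using tridiff_add[OF assms(1) tridiff_minus[OF assms(2)]] by simp

lemma diff_cochains1_additive:
  assumes "b \<in> diff_cochains1"
  shows "b (X + X') f = b X f + b X' f" "b X (f + f') = b X f + b X f'"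
    "b (smult t X) f = smult t (b X f)" "b X (smult t f) = smult t (b X f)"
  using assms
  by (induction b rule: diff_cochains1_induct)
    (simp_all add: higher_pderiv_add higher_pderiv_smult algebra_simps smult_add_right)

lemma tridiff_additive:
  assumes "tridiff c"
  shows "c (X + X') Y f = c X Y f + c X' Y f" "c X (Y + Y') f = c X Y f + c X Y' f"
    "c X Y (f + f') = c X Y f + c X Y f'" "c (smult t X) Y f = smult t (c X Y f)"
    "c X (smult t Y) f = smult t (c X Y f)" "c X Y (smult t f) = smult t (c X Y f)"
  using assms
  by (induction c rule: tridiff_induct)
    (simp_all add: higher_pderiv_add higher_pderiv_smult algebra_simps smult_add_right)

lemma vbracket_minus: "vbracket Y X = - vbracket X Y"
  by (simp add: vbracket_def)

lemma delta1_diff_cochains2: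
  assumes "b \<in> diff_cochains1"
  shows "delta1 \<nu> \<mu> b \<in> diff_cochains2"
proof -
  have "tridiff (\<lambda>X Y f. Lie_dens \<mu> X (b Y f) - b Y (Lie_dens \<nu> X f)
     - (Lie_dens \<mu> Y (b X f) - b X (Lie_dens \<nu> Y f)) - b (vbracket X Y) f)"
    using tridiff_swap[OF tridiff_Lie[OF assms, of \<mu>]] tridiff_swap[OF tridiff_comp_Lie[OF assms, of \<nu>]]
    by (intro tridiff_diff tridiff_Lie tridiff_comp_Lie tridiff_vbracket assms) simp_all
  then have "tridiff (delta1 \<nu> \<mu> b)"
    by (simp add: delta1_apply[abs_def])
  moreover have "delta1 \<nu> \<mu> b Y X = - delta1 \<nu> \<mu> b X Y" for X Y
    using diff_cochains1_additive(3)[OF assms, of "-1" "vbracket X Y"] vbracket_minus[of Y X]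
    by (intro ext) (simp add: delta1_apply)
  ultimately show ?thesis unfolding diff_cochains2_iff by blast
qed


section \<open>Cocycles, coboundaries and the quotient space\<close>

text \<open>The iterated actions cancel because densities form a representation (\<open>L\<close>),
  and the iterated brackets inside \<open>b\<close> cancel by the Jacobi identity
  (\<open>J\<close>).\<close>

lemma delta2_delta1:
  assumes "b \<in> diff_cochains1"
  shows "delta2 \<nu> \<mu> (delta1 \<nu> \<mu> b) X Y Z = 0"
proof (rule ext)
  fix f
  note b = diff_cochains1_additive[OF assms]
  have b_minus: "b (- X) f = - b X f" "b X (- f) = - b X f" for X f
    using b(3)[of "-1" X f] b(4)[of X "-1" f] by simp_all
  have b_diff: "b (X - X') f = b X f - b X' f" "b X (f - f') = b X f - b X f'" for X X' f f'
    using b(1)[of X "- X'" f] b(2)[of X f "- f'"] by (simp_all add: b_minus)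
  have L: "Lie_dens l (vbracket X Y) g = Lie_dens l X (Lie_dens l Y g) - Lie_dens l Y (Lie_dens l X g)" for l X Y g
    using Lie_dens_vbracket[of l X Y] by simp
  have "vbracket (vbracket X Y) Z = vbracket (vbracket X Z) Y - vbracket (vbracket Y Z) X"
    by (simp add: vbracket_def pderiv_mult pderiv_diff algebra_simps)
  then have J: "b (vbracket (vbracket X Y) Z) f = b (vbracket (vbracket X Z) Y) f - b (vbracket (vbracket Y Z) X) f"
    by (simp add: b_diff)
  show "delta2 \<nu> \<mu> (delta1 \<nu> \<mu> b) X Y Z f = 0 f"
    by (simp add: delta2_apply delta1_apply J L b_diff Lie_dens_diff)
qed

lemma cocycles2I:
  assumes "tridiff c" "\<And>X Y. c Y X = - c X Y" "\<And>X Y Z f. delta2 \<nu> \<mu> c X Y Z f = 0"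
  shows "c \<in> cocycles2 \<nu> \<mu>"
  unfolding cocycles2_def diff_cochains2_iff mem_Collect_eq
  by (intro conjI allI assms(1,2) ext) (simp only: assms(3) zero_fun_apply)

lemma cocycles2D:
  assumes "c \<in> cocycles2 \<nu> \<mu>"
  shows "tridiff c" "c Y X = - c X Y" "delta2 \<nu> \<mu> c X Y Z f = 0"
  using assms unfolding cocycles2_def diff_cochains2_iff by (blast, blast, metis (mono_tags, lifting) mem_Collect_eq zero_fun_apply)

lemma delta1_cocycle:
  assumes "b \<in> diff_cochains1"
  shows "delta1 \<nu> \<mu> b \<in> cocycles2 \<nu> \<mu>"
  using assms by (simp add: cocycles2_def delta1_diff_cochains2 delta2_delta1)

lemma delta1_add: "delta1 \<nu> \<mu> (\<lambda>X f. b X f + b' X f) = delta1 \<nu> \<mu> b + delta1 \<nu> \<mu> b'"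
  by (intro ext) (simp add: delta1_apply Lie_dens_add)

lemma delta1_scale: "delta1 \<nu> \<mu> (\<lambda>X f. smult t (b X f)) = scale_cochain2 t (delta1 \<nu> \<mu> b)"
  by (intro ext) (simp add: delta1_apply scale_cochain2_def Lie_dens_smult smult_diff_right)

lemma coboundaries2_add:
  assumes "c \<in> coboundaries2 \<nu> \<mu>" "c' \<in> coboundaries2 \<nu> \<mu>"
  shows "c + c' \<in> coboundaries2 \<nu> \<mu>"
proof -
  obtain b b' where "c = delta1 \<nu> \<mu> b" "c' = delta1 \<nu> \<mu> b'" "b \<in> diff_cochains1" "b' \<in> diff_cochains1"
    using assms unfolding coboundaries2_def by blast
  then show ?thesis
    unfolding coboundaries2_def by (intro rev_image_eqI[OF diff_cochains1_add[of b b']]) (simp_all add: delta1_add)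
qed

lemma coboundaries2_scale:
  assumes "c \<in> coboundaries2 \<nu> \<mu>"
  shows "scale_cochain2 t c \<in> coboundaries2 \<nu> \<mu>"
proof -
  obtain b where "c = delta1 \<nu> \<mu> b" "b \<in> diff_cochains1"
    using assms unfolding coboundaries2_def by blast
  then show ?thesis
    unfolding coboundaries2_def by (intro rev_image_eqI[OF diff_cochains1_scale[of b t]]) (simp_all add: delta1_scale)
qed

lemma scale_cochain2_minus1: "scale_cochain2 (- 1) c = - c"
  by (intro ext) (simp add: scale_cochain2_def)

lemma coboundaries2_minus: "c \<in> coboundaries2 \<nu> \<mu> \<Longrightarrow> - c \<in> coboundaries2 \<nu> \<mu>"
  using coboundaries2_scale[of c \<nu> \<mu> "- 1"] by (simp add: scale_cochain2_minus1)

lemma delta1_0: "delta1 \<nu> \<mu> (\<lambda>X f. 0) = 0"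
  by (intro ext) (simp add: delta1_apply)

lemma coboundaries2_0: "0 \<in> coboundaries2 \<nu> \<mu>"
  unfolding coboundaries2_def by (intro rev_image_eqI[OF diff_cochains1_0]) (simp add: delta1_0)

lemma cocycles2_add:
  assumes "c \<in> cocycles2 \<nu> \<mu>" "c' \<in> cocycles2 \<nu> \<mu>"
  shows "c + c' \<in> cocycles2 \<nu> \<mu>"
proof (rule cocycles2I)
  show "tridiff (c + c')"
    using tridiff_add[OF cocycles2D(1)[OF assms(1)] cocycles2D(1)[OF assms(2)]] by (simp add: plus_fun_def)
  show "(c + c') Y X = - (c + c') X Y" for X Y
    using cocycles2D(2)[OF assms(1), of Y X] cocycles2D(2)[OF assms(2), of Y X] by simp
  have "delta2 \<nu> \<mu> (c + c') X Y Z f = delta2 \<nu> \<mu> c X Y Z f + delta2 \<nu> \<mu> c' X Y Z f" for X Y Z f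
    by (simp add: delta2_apply Lie_dens_add)
  then show "delta2 \<nu> \<mu> (c + c') X Y Z f = 0" for X Y Z f
    by (simp only: cocycles2D(3)[OF assms(1)] cocycles2D(3)[OF assms(2)] add_0)
qed

lemma cocycles2_scale:
  assumes "c \<in> cocycles2 \<nu> \<mu>"
  shows "scale_cochain2 t c \<in> cocycles2 \<nu> \<mu>"
proof (rule cocycles2I)
  show "tridiff (scale_cochain2 t c)"
    using tridiff_scale[OF cocycles2D(1)[OF assms]] by (simp add: scale_cochain2_def)
  show "scale_cochain2 t c Y X = - scale_cochain2 t c X Y" for X Y
    using cocycles2D(2)[OF assms, of Y X] by (simp add: scale_cochain2_def fun_eq_iff)
  have "delta2 \<nu> \<mu> (scale_cochain2 t c) X Y Z f = smult t (delta2 \<nu> \<mu> c X Y Z f)" for X Y Z f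
    by (simp add: delta2_apply scale_cochain2_def Lie_dens_smult smult_diff_right smult_add_right)
  then show "delta2 \<nu> \<mu> (scale_cochain2 t c) X Y Z f = 0" for X Y Z f
    by (simp only: cocycles2D(3)[OF assms] smult_0_right)
qed

lemma cocycles2_diff:
  assumes "c \<in> cocycles2 \<nu> \<mu>" "c' \<in> cocycles2 \<nu> \<mu>"
  shows "c - c' \<in> cocycles2 \<nu> \<mu>"
  using cocycles2_add[OF assms(1) cocycles2_scale[OF assms(2), of "- 1"]]
  by (simp add: scale_cochain2_minus1)

lemma cocycles2_0: "0 \<in> cocycles2 \<nu> \<mu>"
  using delta1_cocycle[OF diff_cochains1_0] unfolding delta1_0 .

lemma equiv_cohomologous: "equiv (cocycles2 \<nu> \<mu>) (cohomologous \<nu> \<mu>)"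
proof (rule equivI)
  show "cohomologous \<nu> \<mu> \<subseteq> cocycles2 \<nu> \<mu> \<times> cocycles2 \<nu> \<mu>"
    by (auto simp: cohomologous_def)
  show "refl_on (cocycles2 \<nu> \<mu>) (cohomologous \<nu> \<mu>)"
    by (auto simp: refl_on_def cohomologous_def coboundaries2_0)
  show "sym (cohomologous \<nu> \<mu>)"
    unfolding sym_def cohomologous_def using coboundaries2_minus by fastforce
  show "trans (cohomologous \<nu> \<mu>)"
  proof (rule transI)
    fix c c' c'' assume *: "(c, c') \<in> cohomologous \<nu> \<mu>" "(c', c'') \<in> cohomologous \<nu> \<mu>"
    then have "(c - c') + (c' - c'') \<in> coboundaries2 \<nu> \<mu>"
      by (intro coboundaries2_add) (auto simp: cohomologous_def)
    then show "(c, c'') \<in> cohomologous \<nu> \<mu>" using * by (simp add: cohomologous_def)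
  qed
qed

lemma coh_class_eq:
  assumes "c \<in> cocycles2 \<nu> \<mu>" "c' \<in> cocycles2 \<nu> \<mu>" "c - c' \<in> coboundaries2 \<nu> \<mu>"
  shows "coh_class \<nu> \<mu> c = coh_class \<nu> \<mu> c'"
  unfolding coh_class_def
  by (rule equiv_class_eq[OF equiv_cohomologous]) (use assms in \<open>simp add: cohomologous_def\<close>)

lemma coh_class_memD:
  assumes "c' \<in> coh_class \<nu> \<mu> c"
  shows "c \<in> cocycles2 \<nu> \<mu>" "c' \<in> cocycles2 \<nu> \<mu>" "c' - c \<in> coboundaries2 \<nu> \<mu>"
  using assms coboundaries2_minus[of "c - c'" \<nu> \<mu>] by (auto simp: coh_class_def cohomologous_def)

lemma coh_class_self: "c \<in> cocycles2 \<nu> \<mu> \<Longrightarrow> c \<in> coh_class \<nu> \<mu> c"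
  by (simp add: coh_class_def cohomologous_def coboundaries2_0)

lemma H2_cases:
  assumes "K \<in> H2 \<nu> \<mu>"
  obtains c where "c \<in> cocycles2 \<nu> \<mu>" "K = coh_class \<nu> \<mu> c"
  using assms unfolding H2_def coh_class_def by (auto elim: quotientE)

lemma coh_class_in_H2: "c \<in> cocycles2 \<nu> \<mu> \<Longrightarrow> coh_class \<nu> \<mu> c \<in> H2 \<nu> \<mu>"
  unfolding H2_def coh_class_def by (rule quotientI)

lemma H2_add_coh_class:
  assumes "c \<in> cocycles2 \<nu> \<mu>" "d \<in> cocycles2 \<nu> \<mu>"
  shows "H2_add \<nu> \<mu> (coh_class \<nu> \<mu> c) (coh_class \<nu> \<mu> d) = coh_class \<nu> \<mu> (c + d)"
proof -
  have "coh_class \<nu> \<mu> (c' + d') = coh_class \<nu> \<mu> (c + d)"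
    if "c' \<in> coh_class \<nu> \<mu> c" "d' \<in> coh_class \<nu> \<mu> d" for c' d'
  proof (rule coh_class_eq)
    have "(c' - c) + (d' - d) \<in> coboundaries2 \<nu> \<mu>"
      by (rule coboundaries2_add[OF coh_class_memD(3)[OF that(1)] coh_class_memD(3)[OF that(2)]])
    then show "(c' + d') - (c + d) \<in> coboundaries2 \<nu> \<mu>" by (simp add: algebra_simps)
  qed (rule cocycles2_add assms coh_class_memD(2)[OF that(1)] coh_class_memD(2)[OF that(2)])+
  then show ?thesis
    unfolding H2_add_def using coh_class_self[OF assms(1)] coh_class_self[OF assms(2)] by blast
qed

lemma H2_scale_coh_class:
  assumes "c \<in> cocycles2 \<nu> \<mu>"
  shows "H2_scale \<nu> \<mu> t (coh_class \<nu> \<mu> c) = coh_class \<nu> \<mu> (scale_cochain2 t c)"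
proof -
  have "coh_class \<nu> \<mu> (scale_cochain2 t c') = coh_class \<nu> \<mu> (scale_cochain2 t c)"
    if "c' \<in> coh_class \<nu> \<mu> c" for c'
  proof (rule coh_class_eq)
    have "scale_cochain2 t (c' - c) \<in> coboundaries2 \<nu> \<mu>"
      by (rule coboundaries2_scale[OF coh_class_memD(3)[OF that]])
    moreover have "scale_cochain2 t (c' - c) = scale_cochain2 t c' - scale_cochain2 t c"
      by (intro ext) (simp add: scale_cochain2_def smult_diff_right)
    ultimately show "scale_cochain2 t c' - scale_cochain2 t c \<in> coboundaries2 \<nu> \<mu>" by simp
  qed (rule cocycles2_scale assms coh_class_memD(2)[OF that])+
  then show ?thesis
    unfolding H2_scale_def using coh_class_self[OF assms] by blast
qed

lemma H2_subspace_H2: "H2_subspace \<nu> \<mu> (H2 \<nu> \<mu>)"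
  unfolding H2_subspace_def H2_zero_def
proof (intro conjI ballI allI order_refl)
  show "coh_class \<nu> \<mu> 0 \<in> H2 \<nu> \<mu>" by (rule coh_class_in_H2[OF cocycles2_0])
next
  fix K L assume "K \<in> H2 \<nu> \<mu>" "L \<in> H2 \<nu> \<mu>"
  then obtain c d where "c \<in> cocycles2 \<nu> \<mu>" "K = coh_class \<nu> \<mu> c" "d \<in> cocycles2 \<nu> \<mu>" "L = coh_class \<nu> \<mu> d"
    by (meson H2_cases)
  then show "H2_add \<nu> \<mu> K L \<in> H2 \<nu> \<mu>"
    by (simp only: H2_add_coh_class coh_class_in_H2 cocycles2_add)
next
  fix t K assume "K \<in> H2 \<nu> \<mu>"
  then obtain c where "c \<in> cocycles2 \<nu> \<mu>" "K = coh_class \<nu> \<mu> c" by (rule H2_cases)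
  then show "H2_scale \<nu> \<mu> t K \<in> H2 \<nu> \<mu>"
    by (simp only: H2_scale_coh_class coh_class_in_H2 cocycles2_scale)
qed

text \<open>A subspace containing the class of the given cocycle contains its multiples, which by
  \<open>ex\<close> are all classes. Conversely \<open>H2\<close> is itself one of the subspaces
  that are intersected.\<close>

lemma H2_spanned_by_nontrivialI:
  assumes "\<Omega> \<in> cocycles2 \<nu> \<mu>" "\<Omega> \<notin> coboundaries2 \<nu> \<mu>"
    and ex: "\<And>c. c \<in> cocycles2 \<nu> \<mu> \<Longrightarrow> \<exists>t. c - scale_cochain2 t \<Omega> \<in> coboundaries2 \<nu> \<mu>"
  shows "H2_spanned_by_nontrivial \<nu> \<mu> \<Omega>"
proof -
  have "H2 \<nu> \<mu> \<subseteq> W" if W: "H2_subspace \<nu> \<mu> W" "coh_class \<nu> \<mu> \<Omega> \<in> W" for W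
  proof
    fix K assume "K \<in> H2 \<nu> \<mu>"
    then obtain c where c: "c \<in> cocycles2 \<nu> \<mu>" "K = coh_class \<nu> \<mu> c" by (rule H2_cases)
    obtain t where "c - scale_cochain2 t \<Omega> \<in> coboundaries2 \<nu> \<mu>" using ex[OF c(1)] by blast
    then have "K = H2_scale \<nu> \<mu> t (coh_class \<nu> \<mu> \<Omega>)"
      using c assms(1) by (simp add: H2_scale_coh_class coh_class_eq cocycles2_scale)
    then show "K \<in> W" using W unfolding H2_subspace_def by blast
  qed
  moreover have "coh_class \<nu> \<mu> \<Omega> \<in> H2 \<nu> \<mu>" by (rule coh_class_in_H2[OF assms(1)])
  ultimately have "H2 \<nu> \<mu> = H2_span \<nu> \<mu> {coh_class \<nu> \<mu> \<Omega>}"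
    unfolding H2_span_def using H2_subspace_H2[of \<nu> \<mu>] by blast
  then show ?thesis using assms(1,2) by (simp add: H2_spanned_by_nontrivial_def nontrivial_cocycle2_def)
qed


section \<open>Translation invariance and reduction to monomials\<close>

abbreviation xpow :: "nat \<Rightarrow> real poly" where
  "xpow \<equiv> monom 1"

lemma poly_dx_0: "poly (dx m p) 0 = fact m * coeff p m"
  by (simp add: poly_0_coeff_0 coeff_higher_pderiv pochhammer_fact[symmetric])

lemma poly_eq_0_if_dx_0:
  assumes "\<And>n. poly (dx n p) 0 = 0"
  shows "p = 0"
  using assms by (intro poly_eqI) (simp add: poly_dx_0)

lemma linear_functional_eq_0:
  fixes \<phi> :: "real poly \<Rightarrow> real"
  assumes add: "\<And>p q. \<phi> (p + q) = \<phi> p + \<phi> q" and scale: "\<And>t p. \<phi> (smult t p) = t * \<phi> p"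
    and "\<And>i. \<phi> (xpow i) = 0"
  shows "\<phi> p = 0"
proof -
  have zero: "\<phi> 0 = 0" using scale[of 0 0] by simp
  have mon: "\<phi> (monom a i) = 0" for a i
    using scale[of a "xpow i"] assms(3)[of i] by (simp add: smult_monom)
  have "\<phi> (\<Sum>i\<in>A. monom (coeff p i) i) = 0" for A :: "nat set"
    by (induction A rule: infinite_finite_induct) (simp_all add: zero add mon)
  then show ?thesis by (metis poly_as_sum_of_monoms)
qed

definition cval :: "cochain2 \<Rightarrow> nat \<Rightarrow> nat \<Rightarrow> nat \<Rightarrow> real" where
  "cval c i j k = poly (c (xpow i) (xpow j) (xpow k)) 0"

definition bval :: "cochain1 \<Rightarrow> nat \<Rightarrow> nat \<Rightarrow> real" where
  "bval b i k = poly (b (xpow i) (xpow k)) 0"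

text \<open>Multilinearity extends the vanishing at the origin from monomials to all arguments. By
  \<open>inv\<close> each derivative of the value is a sum of values at other arguments, so all
  Taylor coefficients at the origin vanish.\<close>

lemma eq_0_if_cval_eq_0:
  assumes c: "tridiff c" and "\<And>i j k. cval c i j k = 0"
    and inv: "\<And>X Y f. pderiv (c X Y f) = c (pderiv X) Y f + c X (pderiv Y) f + c X Y (pderiv f)"
  shows "c X Y f = 0"
proof (rule poly_eq_0_if_dx_0)
  note tri = tridiff_additive[OF c]
  have 2: "poly (c (xpow i) (xpow j) f) 0 = 0" for i j f
    by (rule linear_functional_eq_0[of "\<lambda>f. poly (c (xpow i) (xpow j) f) 0"])
      (simp_all add: tri assms(2)[unfolded cval_def])
  have 1: "poly (c (xpow i) Y f) 0 = 0" for i Y f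
    by (rule linear_functional_eq_0[of "\<lambda>Y. poly (c (xpow i) Y f) 0"]) (simp_all add: tri 2)
  have 0: "poly (c X Y f) 0 = 0" for X Y f
    by (rule linear_functional_eq_0[of "\<lambda>X. poly (c X Y f) 0"]) (simp_all add: tri 1)
  show "poly (dx n (c X Y f)) 0 = 0" for n
    by (induction n arbitrary: X Y f) (simp_all add: 0 funpow_Suc_right inv higher_pderiv_add del: funpow.simps(2))
qed

lemma Lie_dens_1: "Lie_dens l 1 f = pderiv f"
  by (simp add: Lie_dens_def)

lemma vbracket_1: "vbracket 1 Y = pderiv Y"
  by (simp add: vbracket_def)

text \<open>This is the cocycle identity with d/dx as first argument: d/dx acts on densities and on
  vector fields by differentiation, and the terms with \<open>c\<close> evaluated on d/dx drop
  out.\<close>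

lemma cocycle_translation_invariant:
  assumes c: "c \<in> cocycles2 \<nu> \<mu>" and c1: "\<And>Y f. c 1 Y f = 0"
  shows "pderiv (c X Y f) = c (pderiv X) Y f + c X (pderiv Y) f + c X Y (pderiv f)"
proof -
  have "c (pderiv Y) X f = - c X (pderiv Y) f" for X Y f
    using cocycles2D(2)[OF c, of "pderiv Y" X] by simp
  moreover have "c Y 1 f = 0" for Y f
    using cocycles2D(2)[OF c, of Y 1] c1 by simp
  ultimately show ?thesis
    using cocycles2D(3)[OF c, of 1 X Y f] c1 by (simp add: delta2_apply Lie_dens_1 vbracket_1 algebra_simps)
qed

lemma pderiv_sum: "pderiv (sum f A) = (\<Sum>x\<in>A. pderiv (f x))"
  using higher_pderiv_sum[of 1 f A] by simp

lemma ex_antiderivative: "\<exists>q. pderiv q = (p :: real poly)"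
proof -
  have "pderiv (\<Sum>i\<le>degree p. monom (coeff p i / real (Suc i)) (Suc i)) = (\<Sum>i\<le>degree p. monom (coeff p i) i)"
    unfolding pderiv_sum pderiv_monom by (intro sum.cong refl) (simp del: of_nat_Suc)
  then show ?thesis by (metis poly_as_sum_of_monoms)
qed

lemma dx_1: "dx i 1 = (if i = 0 then 1 else (0 :: real poly))"
  by (cases i) (simp_all add: funpow_Suc_right del: funpow.simps(2))

text \<open>If \<open>b\<close> vanishes on d/dx, then \<open>delta1 \<nu> \<mu> b 1\<close> merely
  differentiates the coefficients of \<open>b\<close>; so the coefficients of \<open>c 1\<close>
  have to be integrated.\<close>

lemma ex_coboundary_vanishing_on_translation:
  assumes c: "c \<in> cocycles2 \<nu> \<mu>"
  shows "\<exists>b\<in>diff_cochains1. \<forall>Y f. (c - delta1 \<nu> \<mu> b) 1 Y f = 0"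
proof -
  obtain n p where p: "\<And>X Y f. c X Y f = (\<Sum>i\<le>n. \<Sum>j\<le>(n::nat). \<Sum>k\<le>n. p i j k * dx i X * dx j Y * dx k f)"
    using cocycles2D(1)[OF c] unfolding tridiff_def by blast
  define q where "q = (\<lambda>j k. SOME q. pderiv q = p 0 j k)"
  have q: "pderiv (q j k) = p 0 j k" for j k
    unfolding q_def by (rule someI_ex[OF ex_antiderivative])
  \<comment> \<open>The terms with undifferentiated X are left out to make \<open>b 1\<close>
    vanish.\<close>
  define Q where "Q = (\<lambda>j k. if j = (0::nat) then 0 else q j k)"
  define b :: cochain1 where "b = (\<lambda>X f. \<Sum>j\<le>n. \<Sum>k\<le>n. Q j k * dx j X * dx k f)"
  have b: "b \<in> diff_cochains1" unfolding b_def diff_cochains1_def by blast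
  have b1: "b 1 f = 0" for f
    unfolding b_def by (intro sum.neutral ballI) (simp add: Q_def dx_1)
  have c1: "c 1 Y f = (\<Sum>j\<le>n. \<Sum>k\<le>n. p 0 j k * dx j Y * dx k f)" for Y f
    unfolding p by (subst sum.remove[of _ 0]) (simp_all add: dx_1)
  have "c 1 1 f = 0" for f
    using cocycles2D(2)[OF c, of 1 1] by (metis neg_equal_zero uminus_apply)
  \<comment> \<open>The omitted terms are missing in \<open>c 1\<close> as well: antisymmetry gives
    \<open>c 1 1 = 0\<close>, which is the vanishing of exactly this operator.\<close>
  then have c11: "(\<Sum>k\<le>n. p 0 0 k * dx k f) = 0" for f
    unfolding c1 by (subst (asm) sum.remove[of _ 0]) (simp_all add: dx_1)
  have "delta1 \<nu> \<mu> b 1 Y f = c 1 Y f" for Y f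
  proof -
    have "delta1 \<nu> \<mu> b 1 Y f = pderiv (b Y f) - b Y (pderiv f) - b (pderiv Y) f"
      by (simp add: delta1_apply Lie_dens_1 vbracket_1 b1)
    also have "\<dots> = (\<Sum>j\<le>n. \<Sum>k\<le>n. pderiv (Q j k) * dx j Y * dx k f)"
      unfolding b_def pderiv_sum sum_subtractf[symmetric]
      by (intro sum.cong refl) (simp add: pderiv_mult funpow_swap1 algebra_simps)
    also have "\<dots> = (\<Sum>j\<le>n. \<Sum>k\<le>n. p 0 j k * dx j Y * dx k f) - Y * (\<Sum>k\<le>n. p 0 0 k * dx k f)"
      by (subst (1 2) sum.remove[of _ 0]) (simp_all add: Q_def q sum_distrib_left mult_ac)
    finally show ?thesis unfolding c1 c11 by simp
  qed
  then show ?thesis using b by (intro bexI[of _ b]) simp_all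
qed

subsection \<open>Values on monomials at the origin\<close>

lemma Lie_dens_xpow:
  assumes "1 \<le> i"
  shows "Lie_dens l (xpow i) (xpow k) = smult (real k + l * real i) (xpow (i + k - 1))"
proof (cases k)
  case 0
  then show ?thesis using assms
    by (simp add: Lie_dens_def pderiv_monom mult_monom smult_monom)
next
  case (Suc k')
  then show ?thesis using assms
    by (simp add: Lie_dens_def pderiv_monom mult_monom smult_monom add_monom algebra_simps)
qed

lemma vbracket_xpow:
  assumes "1 \<le> i" "1 \<le> j"
  shows "vbracket (xpow i) (xpow j) = smult (real j - real i) (xpow (i + j - 1))"
  using assms
  by (simp add: vbracket_def pderiv_monom mult_monom smult_monom diff_monom add_ac)

text \<open>For i >= 1 the field vanishes at the origin, so only the term with its derivative
  survives, and this only for the Euler field i = 1.\<close>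

lemma poly_Lie_dens_0:
  assumes "1 \<le> i"
  shows "poly (Lie_dens l (xpow i) p) 0 = (if i = 1 then l else 0) * poly p 0"
  using assms by (auto simp: Lie_dens_def pderiv_monom poly_monom power_0_left)

lemma cval_delta1:
  assumes "b \<in> diff_cochains1" "1 \<le> i" "1 \<le> j"
  shows "cval (delta1 \<nu> \<mu> b) i j k =
    (if i = 1 then \<mu> else 0) * bval b j k - (real k + \<nu> * real i) * bval b j (i + k - 1)
    - ((if j = 1 then \<mu> else 0) * bval b i k - (real k + \<nu> * real j) * bval b i (j + k - 1))
    - (real j - real i) * bval b (i + j - 1) k"
  using assms
  by (simp add: cval_def bval_def delta1_apply poly_Lie_dens_0 Lie_dens_xpow vbracket_xpow
      diff_cochains1_additive[OF assms(1)] del: One_nat_def)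


lemma cval_cocycle:
  assumes c: "c \<in> cocycles2 \<nu> \<mu>" and ijk: "1 \<le> i" "1 \<le> j" "1 \<le> k"
  shows "(if i = 1 then \<mu> else 0) * cval c j k l - (real l + \<nu> * real i) * cval c j k (i + l - 1)
    - ((if j = 1 then \<mu> else 0) * cval c i k l - (real l + \<nu> * real j) * cval c i k (j + l - 1))
    + ((if k = 1 then \<mu> else 0) * cval c i j l - (real l + \<nu> * real k) * cval c i j (k + l - 1))
    - (real j - real i) * cval c (i + j - 1) k l + (real k - real i) * cval c (i + k - 1) j l
    - (real k - real j) * cval c (j + k - 1) i l = 0"
proof -
  have "poly (delta2 \<nu> \<mu> c (xpow i) (xpow j) (xpow k) (xpow l)) 0 = 0"
    using cocycles2D(3)[OF c] by simp
  then show ?thesis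
    using ijk
    by (simp add: cval_def delta2_apply poly_Lie_dens_0 Lie_dens_xpow vbracket_xpow
      tridiff_additive[OF cocycles2D(1)[OF c]] del: One_nat_def)
qed

lemma cval_skew: "c \<in> cocycles2 \<nu> \<mu> \<Longrightarrow> cval c j i k = - cval c i j k"
  using cocycles2D(2)[of c \<nu> \<mu> "xpow j" "xpow i"] by (simp add: cval_def)


lemma dx_xpow_0: "poly (dx m (xpow k)) 0 = (if m = k then fact k else 0)"
  by (simp add: poly_dx_0)

text \<open>Needed so that a 1-cochain built from values of \<open>c\<close> has finite order and is
  again a differential operator.\<close>

lemma cval_eq_0_for_large:
  assumes "tridiff c"
  shows "\<exists>n. \<forall>i j k. n < i \<or> n < j \<or> n < k \<longrightarrow> cval c i j k = 0"
proof -
  obtain n p where p: "\<And>X Y f. c X Y f = (\<Sum>i\<le>n. \<Sum>j\<le>(n::nat). \<Sum>k\<le>n. p i j k * dx i X * dx j Y * dx k f)"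
    using assms unfolding tridiff_def by blast
  have "cval c i j k = 0" if "n < i \<or> n < j \<or> n < k" for i j k
    unfolding cval_def p poly_sum using that
    by (intro sum.neutral ballI) (auto simp: dx_xpow_0)
  then show ?thesis by blast
qed

text \<open>The constant-coefficient operator with values \<open>h\<close> on monomials at the
  origin; the factorials cancel those produced by differentiating the monomials.\<close>

definition const_cochain :: "nat \<Rightarrow> (nat \<Rightarrow> nat \<Rightarrow> real) \<Rightarrow> cochain1" where
  "const_cochain N h X f = (\<Sum>k\<le>N. \<Sum>l\<le>N. [:h k l / (fact k * fact l):] * dx k X * dx l f)"

lemma const_cochain_in_diff_cochains1: "const_cochain N h \<in> diff_cochains1"
  unfolding diff_cochains1_def mem_Collect_eq const_cochain_def
  by (intro exI[of _ N] exI[of _ "\<lambda>k l. [:h k l / (fact k * fact l):]"]) simp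

lemma bval_const_cochain: "bval (const_cochain N h) k l = (if k \<le> N \<and> l \<le> N then h k l else 0)"
proof -
  have "bval (const_cochain N h) k l = (\<Sum>a\<le>N. if a = k then (\<Sum>b\<le>N. if b = l then h k l else 0) else 0)"
    unfolding bval_def const_cochain_def poly_sum
  proof (intro sum.cong refl)
    fix a
    have "(\<Sum>l'\<le>N. poly ([:h a l' / (fact a * fact l'):] * dx a (xpow k) * dx l' (xpow l)) 0)
        = (\<Sum>l'\<le>N. if l' = l then (if a = k then h k l else 0) else 0)"
      by (intro sum.cong refl) (simp add: dx_xpow_0)
    then show "(\<Sum>l'\<le>N. poly ([:h a l' / (fact a * fact l'):] * dx a (xpow k) * dx l' (xpow l)) 0)
        = (if a = k then \<Sum>l'\<le>N. if l' = l then h k l else 0 else 0)"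
      by simp
  qed
  then show ?thesis by simp
qed

subsection \<open>The weight-zero complex\<close>

text \<open>The value at the origin of the differential of the 1-cochain sending \<open>x^j\<close>, \<open>x^(d + 1 - j)\<close> to
  \<open>b j\<close>, taken on \<open>x^i\<close>, \<open>x^j\<close>, \<open>x^(d + 2 - i - j)\<close>; meaningful only for \<open>i + j \<le> d + 2\<close>, where the
  subtraction is not truncated.\<close>

definition wt_cob :: "real \<Rightarrow> nat \<Rightarrow> (nat \<Rightarrow> real) \<Rightarrow> nat \<Rightarrow> nat \<Rightarrow> real" where
  "wt_cob \<nu> d b i j = ((if i = 1 then \<nu> + real d else 0) - (real (d + 2 - i - j) + \<nu> * real i)) * b j
    - ((if j = 1 then \<nu> + real d else 0) - (real (d + 2 - i - j) + \<nu> * real j)) * b i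
    - (real j - real i) * b (i + j - 1)"

text \<open>The correcting cochain off weight zero is the contraction of \<open>c\<close> with the Euler field, divided by
  the weight.\<close>

lemma coboundaryI_weight_zero:
  assumes c: "c \<in> cocycles2 \<nu> (\<nu> + real d)" and c1: "\<And>Y f. c 1 Y f = 0"
    and \<beta>: "\<And>i j. 1 \<le> i \<Longrightarrow> 1 \<le> j \<Longrightarrow> i + j \<le> d + 2 \<Longrightarrow> cval c i j (d + 2 - i - j) = wt_cob \<nu> d \<beta> i j"
  shows "c \<in> coboundaries2 \<nu> (\<nu> + real d)"
proof -
  let ?\<mu> = "\<nu> + real d"
  obtain n where n: "\<And>i j k. n < i \<or> n < j \<or> n < k \<Longrightarrow> cval c i j k = 0"
    using cval_eq_0_for_large[OF cocycles2D(1)[OF c]] by blast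
  \<comment> \<open>The value 0 at k = 0 makes \<open>b\<close> vanish on d/dx. Since
    \<open>b\<close> has constant coefficients, subtracting its differential then keeps
    \<open>c1\<close>.\<close>
  define h where "h = (\<lambda>k l. if k = 0 then 0 else if k + l = d + 1 then \<beta> k
      else cval c 1 k l / (real d + 1 - real k - real l))"
  define N where "N = max n (d + 1)"
  define b where "b = const_cochain N h"
  have b: "b \<in> diff_cochains1" unfolding b_def by (rule const_cochain_in_diff_cochains1)
  have bv: "bval b k l = h k l" for k l
    unfolding b_def bval_const_cochain using n[of 1 k l]
    by (auto simp: h_def N_def le_max_iff_disj not_le)
  \<comment> \<open>Off weight zero this is c(x,x), which is 0 by antisymmetry. It removes those
    terms of the differential in which \<open>b\<close> is applied to the Euler field.\<close>
  have h1: "h 1 l = 0" if "l \<noteq> d" for l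
    using that cval_skew[OF c, of 1 1 l] by (auto simp: h_def)
  define c' where "c' = c - delta1 \<nu> ?\<mu> b"
  have c': "c' \<in> cocycles2 \<nu> ?\<mu>"
    unfolding c'_def by (intro cocycles2_diff c delta1_cocycle b)
  have c'v: "cval c' i j k = cval c i j k - cval (delta1 \<nu> ?\<mu> b) i j k" for i j k
    by (simp add: c'_def cval_def)
  have b1: "b 1 f = 0" for f
    unfolding b_def const_cochain_def by (intro sum.neutral ballI) (simp add: h_def dx_1)
  have pd: "pderiv (b Y f) = b (pderiv Y) f + b Y (pderiv f)" for Y f
    unfolding b_def const_cochain_def pderiv_sum sum.distrib[symmetric]
    by (intro sum.cong refl) (simp add: pderiv_smult pderiv_mult funpow_swap1 smult_add_right algebra_simps)
  have c'1: "c' 1 Y f = 0" for Y f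
    by (simp add: c'_def delta1_apply Lie_dens_1 vbracket_1 b1 pd c1)
  have c'0: "cval c' 0 j k = 0" "cval c' j 0 k = 0" for j k
    using c'1 cval_skew[OF c', of 0 j k] by (simp_all add: cval_def)
  have c'x: "cval c' 1 k l = 0" if "1 \<le> k" "k + l \<noteq> d + 1" for k l
  proof -
    have "cval (delta1 \<nu> ?\<mu> b) 1 k l = (real d + 1 - real k - real l) * h k l"
      using that h1[of l] h1[of "k + l - 1"]
      by (subst cval_delta1[OF b]) (auto simp: bv algebra_simps)
    also have "\<dots> = cval c 1 k l"
    proof -
      have "real d + 1 - real k - real l \<noteq> 0"
      proof
        assume "real d + 1 - real k - real l = 0"
        then have "real (k + l) = real (d + 1)" by simp
        then show False using that(2) by (simp only: of_nat_eq_iff)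
      qed
      then show ?thesis using that by (simp add: h_def)
    qed
    finally show ?thesis by (simp add: c'v)
  qed
  have v0: "cval c' i j k = 0" for i j k
  proof (cases "i = 0 \<or> j = 0")
    case True
    then show ?thesis using c'0 by auto
  next
    case False
    then have ij: "1 \<le> i" "1 \<le> j" by auto
    show ?thesis
    proof (cases "i + j + k = d + 2")
      case True
      then have k: "k = d + 2 - i - j" and ijd: "i + j \<le> d + 2" by auto
      have "cval (delta1 \<nu> ?\<mu> b) i j k = wt_cob \<nu> d \<beta> i j"
        using ij ijd by (subst cval_delta1[OF b ij]) (auto simp: bv h_def wt_cob_def k algebra_simps)
      then show ?thesis using \<beta>[OF ij ijd] by (simp add: c'v k)
    next
      case off: False
      \<comment> \<open>In the cocycle identity with the Euler field as first argument these are the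
        terms in which \<open>c'\<close> still has the Euler field as an argument;
        \<open>c'x\<close> kills them. The others add up to the weight times
        \<open>cval c' i j k\<close>.\<close>
      have z: "cval c' (i + j - 1) 1 k = 0"
        using c'x[of "i + j - 1" k] cval_skew[OF c', of 1 "i + j - 1" k] ij off by auto
      have zi: "(real k + \<nu> * real i) * cval c' 1 j (i + k - 1) = 0" 
        using c'x[of j "i + k - 1"] ij off by auto
      have zj: "(real k + \<nu> * real j) * cval c' 1 i (j + k - 1) = 0" 
        using c'x[of i "j + k - 1"] ij off by auto
      have zi1: "(if i = 1 then ?\<mu> else 0) * cval c' 1 j k = 0" 
        using c'x[of j k] ij off by auto
      have zj1: "(if j = 1 then ?\<mu> else 0) * cval c' 1 i k = 0" 
        using c'x[of i k] ij off by auto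
      have sk: "cval c' j i k = - cval c' i j k" by (rule cval_skew[OF c'])
      have "(real d + 2 - real i - real j - real k) * cval c' i j k = 0"
        using cval_cocycle[OF c' order_refl ij, of k]
        unfolding zi zj zi1 zj1 z by (simp add: sk algebra_simps)
      moreover have "real d + 2 - real i - real j - real k \<noteq> 0"
      proof
        assume "real d + 2 - real i - real j - real k = 0"
        then have "real (i + j + k) = real (d + 2)" by simp
        then show False using off by (simp only: of_nat_eq_iff)
      qed
      ultimately show ?thesis by simp
    qed
  qed
  have "c' X Y f = 0" for X Y f
    by (rule eq_0_if_cval_eq_0[OF cocycles2D(1)[OF c'] v0 cocycle_translation_invariant[OF c' c'1]])
  then have "c' = 0" by (simp add: fun_eq_iff)
  then have "c = delta1 \<nu> ?\<mu> b" by (simp add: c'_def)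
  then show ?thesis using b by (simp add: coboundaries2_def)
qed


section \<open>Cocycle equations and normalisation of arrays\<close>

text \<open>The equations are those of \<open>cval_cocycle\<close> with the fourth exponent chosen
  to give total weight zero. Antisymmetry can be asked for all indices because truncated subtraction
  of i and j is symmetric in them.\<close>

definition wt_cocycle :: "real \<Rightarrow> nat \<Rightarrow> (nat \<Rightarrow> nat \<Rightarrow> real) \<Rightarrow> bool" where
  "wt_cocycle \<nu> d z \<longleftrightarrow> (\<forall>i j. z j i = - z i j) \<and>
    (\<forall>i j k. 1 \<le> i \<longrightarrow> 1 \<le> j \<longrightarrow> 1 \<le> k \<longrightarrow> i + j + k \<le> d + 3 \<longrightarrow>
      ((if i = 1 then \<nu> + real d else 0) - (real (d + 3 - i - j - k) + \<nu> * real i)) * z j k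
      - ((if j = 1 then \<nu> + real d else 0) - (real (d + 3 - i - j - k) + \<nu> * real j)) * z i k
      + ((if k = 1 then \<nu> + real d else 0) - (real (d + 3 - i - j - k) + \<nu> * real k)) * z i j
      - (real j - real i) * z (i + j - 1) k + (real k - real i) * z (i + k - 1) j
      - (real k - real j) * z (j + k - 1) i = 0)"

lemma wt_cocycleD:
  assumes "wt_cocycle \<nu> d z" "1 \<le> i" "1 \<le> j" "1 \<le> k" "i + j + k \<le> d + 3"
  shows "((if i = 1 then \<nu> + real d else 0) - (real (d + 3 - i - j - k) + \<nu> * real i)) * z j k
      - ((if j = 1 then \<nu> + real d else 0) - (real (d + 3 - i - j - k) + \<nu> * real j)) * z i k
      + ((if k = 1 then \<nu> + real d else 0) - (real (d + 3 - i - j - k) + \<nu> * real k)) * z i j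
      - (real j - real i) * z (i + j - 1) k + (real k - real i) * z (i + k - 1) j
      - (real k - real j) * z (j + k - 1) i = 0"
  using assms unfolding wt_cocycle_def by blast

lemma wt_cocycle_skew: "wt_cocycle \<nu> d z \<Longrightarrow> z j i = - z i j"
  unfolding wt_cocycle_def by blast

text \<open>The solution \<open>b\<close> of \<open>wt_cob \<nu> d b 2 j = w j\<close> for \<open>j \<ge> 3\<close> with \<open>b 1 = b 3 = 0\<close> and \<open>b 2 = \<beta>\<close>.\<close>

primrec wt_lift :: "real \<Rightarrow> nat \<Rightarrow> (nat \<Rightarrow> real) \<Rightarrow> real \<Rightarrow> nat \<Rightarrow> real" where
  "wt_lift \<nu> d w \<beta> 0 = 0"
| "wt_lift \<nu> d w \<beta> (Suc j) = (if j < 3 then if j = 1 then \<beta> else 0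
     else ((real (d - j) + \<nu> * real j) * \<beta> - (real (d - j) + \<nu> * 2) * wt_lift \<nu> d w \<beta> j - w j) / (real j - 2))"

lemma wt_cob_lift:
  assumes "3 \<le> j"
  shows "wt_cob \<nu> d (wt_lift \<nu> d w \<beta>) 2 j = w j"
proof -
  have 2: "wt_lift \<nu> d w \<beta> 2 = \<beta>" by (simp add: numeral_2_eq_2)
  have "real j \<noteq> 2" using assms by simp
  moreover have "wt_lift \<nu> d w \<beta> (2 + j - 1) = wt_lift \<nu> d w \<beta> (Suc j)" by simp
  ultimately show ?thesis using assms
    unfolding wt_cob_def 2 by (simp add: field_simps)
qed

lemma wt_lift_linear:
  "wt_lift \<nu> d (\<lambda>j. w j + t * w' j) (\<beta> + t * \<beta>') j = wt_lift \<nu> d w \<beta> j + t * wt_lift \<nu> d w' \<beta>' j"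
  by (induction j) (simp_all add: add_divide_distrib[symmetric] algebra_simps)

lemma wt_cob_linear: "wt_cob \<nu> d (\<lambda>j. b j + t * b' j) i j = wt_cob \<nu> d b i j + t * wt_cob \<nu> d b' i j"
  by (simp add: wt_cob_def algebra_simps)

text \<open>The lift of zero with b(2) = 1 spans the directions with b(1) = b(3) = 0 that leave the
  entries (2,j), j >= 3, unchanged. The pivot is its effect on the entry (3,4).\<close>

definition pivot_coeff :: "real \<Rightarrow> nat \<Rightarrow> real" where
  "pivot_coeff \<nu> d = wt_cob \<nu> d (wt_lift \<nu> d (\<lambda>_. 0) 1) 3 4"

text \<open>The entries (2,j) force \<open>b\<close> to be \<open>b 2\<close> times the homogeneous
  lift; its entry (3,4) is then \<open>b 2\<close> times the pivot. This is applied to the Euler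
  contraction of a 2-cocycle.\<close>

lemma wt_kernel_trivial:
  assumes "b 1 = 0" "b 3 = 0" "\<And>j. 3 \<le> j \<Longrightarrow> j \<le> d \<Longrightarrow> wt_cob \<nu> d b 2 j = 0" "wt_cob \<nu> d b 3 4 = 0"
    and "pivot_coeff \<nu> d \<noteq> 0" "5 \<le> d" "1 \<le> j" "j \<le> d + 1"
  shows "b j = 0"
proof -
  define h where "h = wt_lift \<nu> d (\<lambda>_. 0) 1"
  have b: "b j = b 2 * h j" if "1 \<le> j" "j \<le> d + 1" for j
    using that
  proof (induction j)
    case (Suc j)
    consider "j = 0" | "j = 1" | "j = 2" | "3 \<le> j" by linarith
    then show ?case
    proof cases
      case 4
      have "wt_cob \<nu> d b 2 j - b 2 * wt_cob \<nu> d h 2 j = 0"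
        using assms(3)[of j] wt_cob_lift[OF 4] Suc 4 by (simp add: h_def)
      moreover have "b j = b 2 * h j" "h 2 = 1" using Suc 4 by (auto simp: h_def numeral_2_eq_2)
      ultimately have "(real j - 2) * (b (Suc j) - b 2 * h (Suc j)) = 0"
        unfolding wt_cob_def using 4 by (simp add: algebra_simps)
      then show ?thesis using 4 by simp
    qed (use assms(1,2) in \<open>simp_all add: h_def numeral_2_eq_2 numeral_3_eq_3\<close>)
  qed simp
  have "wt_cob \<nu> d b 3 4 = b 2 * wt_cob \<nu> d h 3 4"
    using b[of 3] b[of 4] b[of 6] \<open>5 \<le> d\<close> by (simp add: wt_cob_def algebra_simps)
  then have "b 2 = 0" using assms(4,5) by (simp add: pivot_coeff_def h_def)
  then show ?thesis using b assms(7,8) by simp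
qed

text \<open>The two differences are the entries at (4,5) and (3,4) once the entries (2,j) have been
  normalised to 0; the combination is the one that also ignores the remaining freedom in \<open>b 2\<close>.\<close>

definition wt_functional :: "real \<Rightarrow> nat \<Rightarrow> (nat \<Rightarrow> nat \<Rightarrow> real) \<Rightarrow> real" where
  "wt_functional \<nu> d z = pivot_coeff \<nu> d * (z 4 5 - wt_cob \<nu> d (wt_lift \<nu> d (z 2) 0) 4 5)
     - wt_cob \<nu> d (wt_lift \<nu> d (\<lambda>_. 0) 1) 4 5 * (z 3 4 - wt_cob \<nu> d (wt_lift \<nu> d (z 2) 0) 3 4)"

lemma wt_functional_linear: "wt_functional \<nu> d (\<lambda>i j. z i j + t * z' i j) = wt_functional \<nu> d z + t * wt_functional \<nu> d z'"
proof -
  have "wt_lift \<nu> d (\<lambda>j. z 2 j + t * z' 2 j) 0 = (\<lambda>j. wt_lift \<nu> d (z 2) 0 j + t * wt_lift \<nu> d (z' 2) 0 j)"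
    using wt_lift_linear[of \<nu> d "z 2" t "z' 2" 0 0] by auto
  then show ?thesis by (simp add: wt_functional_def wt_cob_linear algebra_simps)
qed

lemma wt_lift_numerals:
  "wt_lift \<nu> d w \<beta> 2 = \<beta>" "wt_lift \<nu> d w \<beta> 3 = 0"
  "wt_lift \<nu> d w \<beta> 4 = (real (d - 3) + \<nu> * 3) * \<beta> - w 3"
  "wt_lift \<nu> d w \<beta> 5 = ((real (d - 4) + \<nu> * 4) * \<beta> - (real (d - 4) + \<nu> * 2) * wt_lift \<nu> d w \<beta> 4 - w 4) / 2"
  "wt_lift \<nu> d w \<beta> 6 = ((real (d - 5) + \<nu> * 5) * \<beta> - (real (d - 5) + \<nu> * 2) * wt_lift \<nu> d w \<beta> 5 - w 5) / 3"
  "wt_lift \<nu> d w \<beta> 7 = ((real (d - 6) + \<nu> * 6) * \<beta> - (real (d - 6) + \<nu> * 2) * wt_lift \<nu> d w \<beta> 6 - w 6) / 4"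
  "wt_lift \<nu> d w \<beta> 8 = ((real (d - 7) + \<nu> * 7) * \<beta> - (real (d - 7) + \<nu> * 2) * wt_lift \<nu> d w \<beta> 7 - w 7) / 5"
  using wt_lift.simps(2)[of \<nu> d w \<beta> 1] wt_lift.simps(2)[of \<nu> d w \<beta> 2] wt_lift.simps(2)[of \<nu> d w \<beta> 3]
    wt_lift.simps(2)[of \<nu> d w \<beta> 4] wt_lift.simps(2)[of \<nu> d w \<beta> 5] wt_lift.simps(2)[of \<nu> d w \<beta> 6]
    wt_lift.simps(2)[of \<nu> d w \<beta> 7]
  by (simp_all add: eval_nat_numeral del: wt_lift.simps(2))

text \<open>Only entries with both indices at least 2 are read, so b(1) is absent. For d - 2 + 3 nu
  nonzero, b(3) can be removed by the kernel of \<open>wt_cob\<close>; what is left differs from the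
  lift by a multiple of the homogeneous one, which the combination ignores. The expansion is an
  identity of polynomials in nu, so it covers the exceptional weight too.\<close>

lemma wt_functional_wt_cob:
  assumes "d = 9 \<or> d = 10"
  shows "wt_functional \<nu> d (wt_cob \<nu> d b) = 0"
  using assms
  by (elim disjE) (simp_all add: wt_functional_def pivot_coeff_def wt_cob_def wt_lift_numerals field_simps)

lemma ex_gauge:
  assumes "pivot_coeff \<nu> d \<noteq> 0" "real d - 2 + 3 * \<nu> \<noteq> 0" "5 \<le> d"
  shows "\<exists>b. z 1 3 = wt_cob \<nu> d b 1 3 \<and> z 3 4 = wt_cob \<nu> d b 3 4 \<and>
    (\<forall>j. 3 \<le> j \<longrightarrow> j \<le> d \<longrightarrow> z 2 j = wt_cob \<nu> d b 2 j)"
proof -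
  define h where "h = wt_lift \<nu> d (\<lambda>_. 0) 1"
  define e where "e = wt_lift \<nu> d (z 2) 0"
  define t where "t = (z 3 4 - wt_cob \<nu> d e 3 4) / pivot_coeff \<nu> d"
  \<comment> \<open>\<open>e\<close> matches the entries (2,j), and adding \<open>t\<close> times
    \<open>h\<close> corrects the entry (3,4) without changing them. The value at 1 is free for the
    entry (1,3), where b(3) cancels and b(1) has coefficient d - 2 + 3 nu.\<close>
  define b where "b = (\<lambda>j. if j = 1 then z 1 3 / (real d - 2 + 3 * \<nu>) else e j + t * h j)"
  have b: "wt_cob \<nu> d b i j = wt_cob \<nu> d e i j + t * wt_cob \<nu> d h i j" if "2 \<le> i" "2 \<le> j" for i j
  proof -
    have "i + j - Suc 0 \<noteq> Suc 0" using that by simp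
    then show ?thesis using that by (simp add: wt_cob_def b_def algebra_simps)
  qed
  have "wt_cob \<nu> d b 1 3 = z 1 3"
    using assms(2,3) by (simp add: wt_cob_def b_def algebra_simps of_nat_diff divide_simps)
  moreover have "wt_cob \<nu> d b 3 4 = z 3 4"
    using assms(1) b[of 3 4] by (simp add: t_def pivot_coeff_def h_def)
  moreover have "wt_cob \<nu> d b 2 j = z 2 j" if "3 \<le> j" for j
    using b[of 2 j] that by (simp add: e_def h_def wt_cob_lift)
  ultimately show ?thesis by metis
qed

text \<open>The contraction of a cocycle of weight zero with the Euler field is a 1-cocycle.\<close>

lemma wt_cocycle_1:
  assumes z: "wt_cocycle \<nu> d z" and "1 \<le> j" "1 \<le> k" "j + k \<le> d + 2"
  shows "wt_cob \<nu> d (z 1) j k = 0"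
proof -
  have "real (d + 3 - 1 - j - k) = real d + 2 - real j - real k"
    "real (d + 2 - j - k) = real d + 2 - real j - real k" using assms(4) by (simp_all add: of_nat_diff)
  moreover have "z (j + k - 1) 1 = - z 1 (j + k - 1)" "z k j = - z j k" using wt_cocycle_skew[OF z] by blast+
  ultimately show ?thesis
    using wt_cocycleD[OF z order_refl assms(2,3)] assms(4)
    unfolding wt_cob_def by (simp add: algebra_simps)
qed


text \<open>With z(2,j) = 0 the equation at (2,j,k) relates the entries with index sum j + k + 1 to
  z(j,k), so the antidiagonals can be treated one after the other.\<close>

lemma wt_cocycle_eq_0:
  assumes d: "d = 9 \<or> d = 10" and z: "wt_cocycle \<nu> d z" and det: "pivot_coeff \<nu> d \<noteq> 0"
    and z13: "z 1 3 = 0" and z34: "z 3 4 = 0" and z45: "z 4 5 = 0"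
    and z2: "\<And>j. 3 \<le> j \<Longrightarrow> j \<le> d \<Longrightarrow> z 2 j = 0"
    and ij: "1 \<le> i" "1 \<le> j" "i + j \<le> d + 2"
  shows "z i j = 0"
proof -
  note sk = wt_cocycle_skew[OF z]
  have self: "z i i = 0" for i using sk[of i i] by simp
  \<comment> \<open>The row z(1,j) is a 1-cocycle with entry 0 at j = 1 by antisymmetry and at j = 3
    by normalisation.\<close>
  have "wt_cob \<nu> d (z 1) 2 j = 0" if "3 \<le> j" "j \<le> d" for j
    using that by (intro wt_cocycle_1[OF z]) auto
  moreover have "5 \<le> d" using d by auto
  moreover have "wt_cob \<nu> d (z 1) 3 4 = 0"
    using d by (intro wt_cocycle_1[OF z]) auto
  ultimately have z1: "z 1 j = 0" if "1 \<le> j" "j \<le> d + 1" for j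
    using wt_kernel_trivial[OF self z13 _ _ det _ that] by blast
  have z21: "z 2 1 = 0" using z1[of 2] sk[of 1 2] d by auto
  note eqs = wt_cocycleD[OF z]
  have z35: "z 3 5 = 0"
    using eqs[of 2 3 4] d z2 z34 sk[of 2 4] sk[of 2 5] sk[of 2 6] sk[of 3 5] sk[of 3 4] by (auto simp: self)
  have z36: "z 3 6 = 0" 
    using eqs[of 2 3 5] d z2 z35 z45 sk[of 2 4] sk[of 2 5] sk[of 2 6] sk[of 2 7] sk[of 3 6] sk[of 4 5] by (auto simp: self)
  have z46: "z 4 6 = 0" 
    using eqs[of 2 4 5] d z2 z45 sk[of 2 4] sk[of 2 5] sk[of 2 6] sk[of 2 8] sk[of 4 6] self[of 5] by (auto simp: self)
  have z37: "z 3 7 = 0" 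
    using eqs[of 2 3 6] d z2 z36 z46 sk[of 2 3] sk[of 2 6] sk[of 2 8] sk[of 3 7] sk[of 4 6] by (auto simp: self)
  \<comment> \<open>On i + j = 11 the equations with an index 2 leave one unknown: z(4,7) = -5
    z(3,8) and z(5,6) = 10 z(3,8). The equation at (3,4,5) then becomes 21 z(3,8) = 0.\<close>
  have e1: "z 4 7 = - 5 * z 3 8" 
    using eqs[of 2 3 7] d z2 z37 sk[of 2 9] sk[of 3 8] by (auto simp: self)
  have e2: "z 5 6 = - 2 * z 4 7" 
    using eqs[of 2 4 6] d z2 z46 sk[of 2 9] sk[of 4 7] by (auto simp: self)
  have e3: "z 5 6 - 2 * z 4 7 + z 3 8 = 0" 
    using eqs[of 3 4 5] d z35 z34 z45 sk[of 5 6] sk[of 4 7] sk[of 3 8] by (auto simp: self)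
  have z38: "z 3 8 = 0" and z47: "z 4 7 = 0" and z56: "z 5 6 = 0" using e1 e2 e3 by simp_all
  \<comment> \<open>Only d = 10 has the further antidiagonal i + j = 12, where equations with an
    index 2 suffice.\<close>
  have z10: "z 5 7 = 0 \<and> z 4 8 = 0 \<and> z 3 9 = 0" if "d = 10"
  proof -
    have a: "z 5 7 = 0" using eqs[of 2 5 6] that z2 z56 sk[of 2 10] sk[of 5 7] self[of 6] by (auto simp: self)
    have b: "z 4 8 = 0" using eqs[of 2 4 7] that z2 z47 a sk[of 2 10] sk[of 4 8] by (auto simp: self)
    have "z 3 9 = 0" using eqs[of 2 3 8] that z2 z38 b sk[of 2 10] sk[of 3 9] by (auto simp: self)
    then show ?thesis using a b by simp
  qed
  have lt: "z i j = 0" if ij: "1 \<le> i" "i < j" "i + j \<le> d + 2" for i j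
  proof -
    consider "i = 1" | "i = 2" | "i = 3" | "i = 4" | "i = 5" using ij d by linarith
    then show ?thesis
    proof cases
      case 1 then show ?thesis using z1 ij by simp
    next
      case 2 then show ?thesis using z2 ij by simp
    next
      case 3
      then consider "j = 4" | "j = 5" | "j = 6" | "j = 7" | "j = 8" | "j = 9" "d = 10" using ij d by linarith
      then show ?thesis by cases (use 3 z34 z35 z36 z37 z38 z10 in auto)
    next
      case 4
      then consider "j = 5" | "j = 6" | "j = 7" | "j = 8" "d = 10" using ij d by linarith
      then show ?thesis by cases (use 4 z45 z46 z47 z10 in auto)
    next
      case 5
      then consider "j = 6" | "j = 7" "d = 10" using ij d by linarith
      then show ?thesis by cases (use 5 z56 z10 in auto)
    qed
  qed
  show ?thesis
    using lt[of i j] lt[of j i] ij self[of i] sk[of j i] by (cases i j rule: linorder_cases) auto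
qed

section \<open>From cochains to arrays; the criterion for spanning\<close>

definition wt_part :: "nat \<Rightarrow> cochain2 \<Rightarrow> nat \<Rightarrow> nat \<Rightarrow> real" where
  "wt_part d c i j = cval c i j (d + 2 - i - j)"

lemma wt_cocycle_wt_part:
  assumes "c \<in> cocycles2 \<nu> (\<nu> + real d)"
  shows "wt_cocycle \<nu> d (wt_part d c)"
  unfolding wt_cocycle_def
proof (intro conjI allI impI)
  show "wt_part d c j i = - wt_part d c i j" for i j
    using cval_skew[OF assms, of j i "d + 2 - i - j"] by (simp add: wt_part_def diff_diff_eq add.commute)
next
  fix i j k :: nat
  assume ijk: "1 \<le> i" "1 \<le> j" "1 \<le> k" and "i + j + k \<le> d + 3"
  \<comment> \<open>Naming the fourth exponent turns every truncated subtraction below into a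
    sum.\<close>
  then obtain l where l: "d + 3 = i + j + k + l" by (metis le_Suc_ex)
  have 1: "d + 3 - i - j - k = l" "d + 2 - j - k = i + l - 1" "d + 2 - i - k = j + l - 1" "d + 2 - i - j = k + l - 1"
    "d + 2 - (i + j - 1) - k = l" "d + 2 - (i + k - 1) - j = l" "d + 2 - (j + k - 1) - i = l"
    using l ijk by auto
  show "((if i = 1 then \<nu> + real d else 0) - (real (d + 3 - i - j - k) + \<nu> * real i)) * wt_part d c j k
      - ((if j = 1 then \<nu> + real d else 0) - (real (d + 3 - i - j - k) + \<nu> * real j)) * wt_part d c i k
      + ((if k = 1 then \<nu> + real d else 0) - (real (d + 3 - i - j - k) + \<nu> * real k)) * wt_part d c i j
      - (real j - real i) * wt_part d c (i + j - 1) k + (real k - real i) * wt_part d c (i + k - 1) j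
      - (real k - real j) * wt_part d c (j + k - 1) i = 0"
    using cval_cocycle[OF assms ijk, of l] ijk unfolding wt_part_def 1
    by (cases "i = 1"; cases "j = 1"; cases "k = 1") (simp_all add: algebra_simps)
qed

lemma wt_part_delta1:
  assumes "b \<in> diff_cochains1" "1 \<le> i" "1 \<le> j" "i + j \<le> d + 2"
  shows "wt_part d (delta1 \<nu> (\<nu> + real d) b) i j = wt_cob \<nu> d (\<lambda>j. bval b j (d + 1 - j)) i j"
proof -
  obtain k where k: "d + 2 = i + j + k" using assms(4) by (metis le_Suc_ex)
  have 1: "d + 2 - i - j = k" "d + 1 - j = i + k - 1" "d + 1 - i = j + k - 1" "d + 1 - (i + j - 1) = k"
    using k assms(2,3) by auto
  show ?thesis
    unfolding wt_part_def wt_cob_def 1 cval_delta1[OF assms(1-3)]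
    by (cases "i = 1"; cases "j = 1") (simp_all add: algebra_simps)
qed

lemma wt_lift_cong:
  assumes "\<And>i. 3 \<le> i \<Longrightarrow> i < j \<Longrightarrow> w i = w' i"
  shows "wt_lift \<nu> d w \<beta> j = wt_lift \<nu> d w' \<beta> j"
  using assms by (induction j) simp_all

text \<open>\<open>wt_part\<close> of a coboundary agrees with \<open>wt_cob\<close> only for i + j
  <= d + 2. The functional reads just (3,4), (4,5) and (2,j) with 3 <= j <= 7, all in this
  range.\<close>

lemma wt_functional_cong:
  assumes "\<And>i j. 1 \<le> i \<Longrightarrow> 1 \<le> j \<Longrightarrow> i + j \<le> d + 2 \<Longrightarrow> z i j = z' i j" "9 \<le> d"
  shows "wt_functional \<nu> d z = wt_functional \<nu> d z'"
proof -
  have "wt_lift \<nu> d (z 2) 0 j = wt_lift \<nu> d (z' 2) 0 j" if "j \<le> 8" for j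
    using that assms(2) by (intro wt_lift_cong assms(1)) auto
  then have "wt_cob \<nu> d (wt_lift \<nu> d (z 2) 0) 4 5 = wt_cob \<nu> d (wt_lift \<nu> d (z' 2) 0) 4 5"
    "wt_cob \<nu> d (wt_lift \<nu> d (z 2) 0) 3 4 = wt_cob \<nu> d (wt_lift \<nu> d (z' 2) 0) 3 4"
    by (simp_all add: wt_cob_def)
  then show ?thesis using assms by (simp add: wt_functional_def)
qed

lemma wt_functional_delta1:
  assumes "b \<in> diff_cochains1" "d = 9 \<or> d = 10"
  shows "wt_functional \<nu> d (wt_part d (delta1 \<nu> (\<nu> + real d) b)) = 0"
proof -
  have "wt_functional \<nu> d (wt_part d (delta1 \<nu> (\<nu> + real d) b))
      = wt_functional \<nu> d (wt_cob \<nu> d (\<lambda>j. bval b j (d + 1 - j)))"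
    using assms by (intro wt_functional_cong wt_part_delta1) auto
  then show ?thesis using wt_functional_wt_cob[OF assms(2)] by simp
qed

lemma wt_part_diff_scale: "wt_part d (c - scale_cochain2 t c') = (\<lambda>i j. wt_part d c i j + (- t) * wt_part d c' i j)"
  by (intro ext) (simp add: wt_part_def cval_def scale_cochain2_def)

lemma wt_functional_minus_scale:
  "wt_functional \<nu> d (wt_part d (c - scale_cochain2 t c'))
    = wt_functional \<nu> d (wt_part d c) - t * wt_functional \<nu> d (wt_part d c')"
  unfolding wt_part_diff_scale wt_functional_linear by simp

lemma scale_cochain2_1: "scale_cochain2 1 c = c"
  by (intro ext) (simp add: scale_cochain2_def)

lemma coboundaryI_wt_functional:
  assumes d: "d = 9 \<or> d = 10" and nz: "pivot_coeff \<nu> d \<noteq> 0" "real d - 2 + 3 * \<nu> \<noteq> 0"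
    and c: "c \<in> cocycles2 \<nu> (\<nu> + real d)" and f0: "wt_functional \<nu> d (wt_part d c) = 0"
  shows "c \<in> coboundaries2 \<nu> (\<nu> + real d)"
proof -
  let ?\<mu> = "\<nu> + real d"
  obtain b where b: "b \<in> diff_cochains1" and b1: "\<And>Y f. (c - delta1 \<nu> ?\<mu> b) 1 Y f = 0"
    using ex_coboundary_vanishing_on_translation[OF c] by blast
  define c' where "c' = c - delta1 \<nu> ?\<mu> b"
  have c': "c' \<in> cocycles2 \<nu> ?\<mu>"
    unfolding c'_def by (intro cocycles2_diff c delta1_cocycle b)
  define z where "z = wt_part d c'"
  have z: "wt_cocycle \<nu> d z" unfolding z_def by (rule wt_cocycle_wt_part[OF c'])
  have fz: "wt_functional \<nu> d z = 0"
    using wt_functional_minus_scale[of \<nu> d c 1 "delta1 \<nu> ?\<mu> b"] f0 wt_functional_delta1[OF b d]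
    by (simp add: z_def c'_def scale_cochain2_1)
  obtain \<beta> where \<beta>: "z 1 3 = wt_cob \<nu> d \<beta> 1 3" "z 3 4 = wt_cob \<nu> d \<beta> 3 4"
    "\<And>j. 3 \<le> j \<Longrightarrow> j \<le> d \<Longrightarrow> z 2 j = wt_cob \<nu> d \<beta> 2 j"
    using ex_gauge[OF nz, of z] d by auto
  \<comment> \<open>The gauge array is realised by a genuine cochain so that the difference is the
    array of a cocycle. Its vanishing shows that the array of \<open>c'\<close> is
    \<open>wt_cob \<nu> d \<beta>\<close>, the form in which \<open>coboundaryI_weight_zero\<close>
    wants it.\<close>
  define b' where "b' = const_cochain (d + 1) (\<lambda>k l. if k + l = d + 1 then \<beta> k else 0)"
  have b': "b' \<in> diff_cochains1" unfolding b'_def by (rule const_cochain_in_diff_cochains1)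
  define z' where "z' = wt_part d (c' - delta1 \<nu> ?\<mu> b')"
  have z'_cocycle: "wt_cocycle \<nu> d z'"
    unfolding z'_def by (intro wt_cocycle_wt_part cocycles2_diff c' delta1_cocycle b')
  have z': "z' i j = z i j - wt_cob \<nu> d \<beta> i j" if "1 \<le> i" "1 \<le> j" "i + j \<le> d + 2" for i j
  proof -
    have "wt_cob \<nu> d (\<lambda>j. bval b' j (d + 1 - j)) i j = wt_cob \<nu> d \<beta> i j"
      using that by (auto simp: wt_cob_def b'_def bval_const_cochain)
    then show ?thesis
      using wt_part_delta1[OF b' that, of \<nu>] by (simp add: z'_def z_def wt_part_def cval_def)
  qed
  have fz': "wt_functional \<nu> d z' = 0"
    using wt_functional_minus_scale[of \<nu> d c' 1 "delta1 \<nu> ?\<mu> b'"] fz wt_functional_delta1[OF b' d]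
    by (simp add: z_def z'_def scale_cochain2_1)
  have p: "z' 1 3 = 0" "z' 3 4 = 0" "\<And>j. 3 \<le> j \<Longrightarrow> j \<le> d \<Longrightarrow> z' 2 j = 0"
    using d \<beta> by (auto simp: z')
  \<comment> \<open>On a normalised array the lift is zero up to index 8, the largest index that is
    read, and the functional reduces to the pivot times the entry (4,5).\<close>
  have "z' 4 5 = 0"
  proof -
    have "wt_lift \<nu> d (z' 2) 0 j = 0" if "j \<le> 8" for j
      using that d p(3) by (induction j) auto
    then show ?thesis using fz' nz(1) p(2) by (simp add: wt_functional_def wt_cob_def)
  qed
  then have "z' i j = 0" if "1 \<le> i" "1 \<le> j" "i + j \<le> d + 2" for i j
    using wt_cocycle_eq_0[OF d z'_cocycle nz(1)] p that by blast
  then have "c' \<in> coboundaries2 \<nu> ?\<mu>"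
    using b1 z' by (intro coboundaryI_weight_zero[OF c', of \<beta>]) (auto simp: c'_def z_def wt_part_def)
  moreover have "delta1 \<nu> ?\<mu> b \<in> coboundaries2 \<nu> ?\<mu>"
    unfolding coboundaries2_def using b by blast
  ultimately have "c' + delta1 \<nu> ?\<mu> b \<in> coboundaries2 \<nu> ?\<mu>" by (rule coboundaries2_add)
  then show ?thesis by (simp add: c'_def)
qed

lemma H2_spanned_by_nontrivial_criterion:
  assumes d: "d = 9 \<or> d = 10" and nz: "pivot_coeff \<nu> d \<noteq> 0" "real d - 2 + 3 * \<nu> \<noteq> 0"
    and \<Omega>: "\<Omega> \<in> cocycles2 \<nu> (\<nu> + real d)" "wt_functional \<nu> d (wt_part d \<Omega>) \<noteq> 0"
  shows "H2_spanned_by_nontrivial \<nu> (\<nu> + real d) \<Omega>"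
proof (rule H2_spanned_by_nontrivialI[OF \<Omega>(1)])
  show "\<Omega> \<notin> coboundaries2 \<nu> (\<nu> + real d)"
    using wt_functional_delta1[OF _ d] \<Omega>(2) unfolding coboundaries2_def by blast
next
  fix c assume c: "c \<in> cocycles2 \<nu> (\<nu> + real d)"
  \<comment> \<open>The multiple for which the functional vanishes on the difference.\<close>
  define t where "t = wt_functional \<nu> d (wt_part d c) / wt_functional \<nu> d (wt_part d \<Omega>)"
  have "c - scale_cochain2 t \<Omega> \<in> coboundaries2 \<nu> (\<nu> + real d)"
    using \<Omega>(2)
    by (intro coboundaryI_wt_functional[OF d nz] cocycles2_diff[OF c] cocycles2_scale[OF \<Omega>(1)])
      (simp add: wt_functional_minus_scale t_def)
  then show "\<exists>t. c - scale_cochain2 t \<Omega> \<in> coboundaries2 \<nu> (\<nu> + real d)" by blast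
qed


section \<open>Cup-products of 1-cocycles\<close>

definition cocycles1 :: "real \<Rightarrow> real \<Rightarrow> cochain1 set" where
  "cocycles1 \<nu> \<mu> = {b \<in> diff_cochains1. delta1 \<nu> \<mu> b = 0}"

lemma cup_cocycle:
  assumes "b \<in> cocycles1 \<mu> \<rho>" "b' \<in> cocycles1 \<nu> \<mu>"
  shows "cup b b' \<in> cocycles2 \<nu> \<rho>"
proof (rule cocycles2I)
  have d: "b \<in> diff_cochains1" "b' \<in> diff_cochains1" using assms by (simp_all add: cocycles1_def)
  show "tridiff (cup b b')"
    using tridiff_diff[OF tridiff_comp[OF d] tridiff_swap[OF tridiff_comp[OF d]]]
    by (simp add: cup_def[abs_def] fun_diff_def)
  show "cup b b' Y X = - cup b b' X Y" for X Y
    by (simp add: cup_def)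
  fix X Y Z f
  have 0: "delta1 \<mu> \<rho> b X Y g = 0" "delta1 \<nu> \<mu> b' X Y g = 0" for X Y g
    using assms by (simp_all add: cocycles1_def)
  \<comment> \<open>Read as rewrite rules, the 1-cocycle conditions remove all brackets; the rest
    cancels by additivity.\<close>
  have br: "b (vbracket X Y) g = Lie_dens \<rho> X (b Y g) - b Y (Lie_dens \<mu> X g)
      - (Lie_dens \<rho> Y (b X g) - b X (Lie_dens \<mu> Y g))"
    "b' (vbracket X Y) g = Lie_dens \<mu> X (b' Y g) - b' Y (Lie_dens \<nu> X g)
      - (Lie_dens \<mu> Y (b' X g) - b' X (Lie_dens \<nu> Y g))" for X Y g
    using 0[of X Y g] unfolding delta1_apply right_minus_eq by simp_all
  have b_diff: "b X (g - g') = b X g - b X g'" for X g g'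
    using diff_cochains1_additive(2)[OF d(1), of X "g - g'" g'] by simp
  show "delta2 \<nu> \<rho> (cup b b') X Y Z f = 0"
    by (simp add: delta2_apply cup_def br b_diff diff_cochains1_additive(2)[OF d(1)] Lie_dens_diff algebra_simps)
qed

subsection \<open>Homogeneous operators with constant coefficients\<close>

text \<open>The entry \<open>m\<close> of the list is the coefficient of the \<open>m\<close>-th derivative of \<open>X\<close>; the order of
  differentiation of \<open>f\<close> follows from the length, the two orders having sum \<open>length - 1\<close>.\<close>

primrec wt_op :: "real list \<Rightarrow> cochain1" where
  "wt_op [] X f = 0"
| "wt_op (c # cs) X f = smult c (X * dx (length cs) f) + wt_op cs (pderiv X) f"

lemma wt_op_0 [simp]: "wt_op cs 0 f = 0"
  by (induction cs) simp_all

lemma wt_op_smult: "wt_op cs X (smult t f) = smult t (wt_op cs X f)"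
  by (induction cs arbitrary: X) (simp_all add: higher_pderiv_smult smult_add_right mult.commute)

lemma pderiv_wt_op: "pderiv (wt_op cs X f) = wt_op cs (pderiv X) f + wt_op cs X (pderiv f)"
  by (induction cs arbitrary: X)
    (simp_all add: pderiv_add pderiv_smult pderiv_mult smult_add_right funpow_swap1 algebra_simps)

lemma diff_cochains1_precomp_pderiv:
  assumes "b \<in> diff_cochains1"
  shows "(\<lambda>X. b (pderiv X)) \<in> diff_cochains1"
  using assms
proof (induction b rule: diff_cochains1_induct)
  case (mono q i k)
  show ?case using diff_cochains1_mono[of q "Suc i" k] by (simp add: funpow_Suc_right del: funpow.simps(2))
next
  case (add b b')
  then show ?case by (simp add: diff_cochains1_add)
qed

lemma wt_op_in_diff_cochains1: "wt_op cs \<in> diff_cochains1"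
proof (induction cs)
  case Nil
  have "wt_op [] = (\<lambda>X f. 0)" by (intro ext) simp
  then show ?case by (simp only: diff_cochains1_0)
next
  case (Cons c cs)
  have "wt_op (c # cs) = (\<lambda>X f. [:c:] * dx 0 X * dx (length cs) f + wt_op cs (pderiv X) f)"
    by (intro ext) simp
  then show ?case
    by (simp only: diff_cochains1_add diff_cochains1_mono diff_cochains1_precomp_pderiv[OF Cons])
qed

primrec falling :: "real \<Rightarrow> nat \<Rightarrow> real" where
  "falling x 0 = 1"
| "falling x (Suc n) = x * falling (x - 1) n"

lemma falling_eq_0: "k < n \<Longrightarrow> falling (real k) n = 0"
proof (induction n arbitrary: k)
  case (Suc n)
  then show ?case by (cases k) simp_all
qed simp

text \<open>For k < n the exponent is truncated, but the falling factorial is then 0.\<close>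

lemma dx_xpow: "dx n (xpow k) = monom (falling (real k) n) (k - n)"
proof (induction n arbitrary: k)
  case (Suc n)
  have "dx (Suc n) (xpow k) = smult (real k) (dx n (xpow (k - 1)))"
    by (simp add: funpow_Suc_right pderiv_monom smult_monom higher_pderiv_smult[symmetric] del: funpow.simps(2))
  then show ?case by (cases k) (simp_all add: Suc smult_monom)
qed simp

text \<open>\<open>opval cs A j k\<close> is the coefficient of the monomial \<open>wt_op cs (A x^j) (x^k)\<close>.\<close>

primrec opval :: "real list \<Rightarrow> real \<Rightarrow> real \<Rightarrow> real \<Rightarrow> real" where
  "opval [] A x y = 0"
| "opval (c # cs) A x y = c * A * falling y (length cs) + opval cs (A * x) (x - 1) y"

lemma opval_0 [simp]: "opval cs 0 x y = 0"
  by (induction cs arbitrary: x) simp_all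

text \<open>The coefficient \<open>A\<close> is carried along because differentiating x^j changes
  the coefficient as well as the exponent.\<close>

lemma wt_op_monom:
  "wt_op cs (monom A j) (xpow k) =
    (if length cs \<le> j + k + 1 then monom (opval cs A (real j) (real k)) (j + k + 1 - length cs) else 0)"
proof (induction cs arbitrary: A j)
  case (Cons c cs)
  show ?case
  proof (cases j)
    case 0
    then show ?thesis
      by (cases "length cs \<le> k") (simp_all add: dx_xpow mult_monom smult_monom pderiv_monom falling_eq_0)
  next
    case (Suc j')
    show ?thesis
    proof (cases "length cs \<le> k")
      case True
      then have "Suc (j' + k - length cs) = Suc (j' + k) - length cs" by simp
      then show ?thesis using True
        by (simp add: Suc Cons dx_xpow mult_monom smult_monom pderiv_monom add_monom algebra_simps)
    next
      case False
      then show ?thesis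
        by (simp add: Suc Cons dx_xpow mult_monom smult_monom pderiv_monom falling_eq_0 algebra_simps)
    qed
  qed
qed simp

lemma bval_wt_op:
  "bval (wt_op cs) j k = (if length cs = j + k + 1 then opval cs 1 (real j) (real k) else 0)"
  by (auto simp: bval_def wt_op_monom poly_monom power_0_left)

text \<open>The leading 0 makes the operator vanish on d/dx, and with constant coefficients its
  differential vanishes there too, hence is translation invariant. By homogeneity only weight zero
  contributes at the origin, and antisymmetry leaves i < j: a finite check.\<close>

lemma wt_op_cocycle1:
  assumes len: "length cs = D + 1"
    and cob: "\<And>i j. 1 \<le> i \<Longrightarrow> i < j \<Longrightarrow> i + j \<le> D + 2 \<Longrightarrow>
      wt_cob \<nu> D (\<lambda>j. opval (0 # cs) 1 (real j) (real (D + 1 - j))) i j = 0"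
  shows "wt_op (0 # cs) \<in> cocycles1 \<nu> (\<nu> + real D)"
proof -
  let ?b = "wt_op (0 # cs)" and ?\<mu> = "\<nu> + real D"
  have b: "?b \<in> diff_cochains1" by (rule wt_op_in_diff_cochains1)
  define c where "c = delta1 \<nu> ?\<mu> ?b"
  have c: "c \<in> cocycles2 \<nu> ?\<mu>" unfolding c_def by (rule delta1_cocycle[OF b])
  have b1: "?b 1 f = 0" for f by simp
  have c1: "c 1 Y f = 0" for Y f
    unfolding c_def delta1_apply Lie_dens_1 vbracket_1 b1 pderiv_wt_op by simp
  have lt: "cval c i j (D + 2 - i - j) = 0" if "1 \<le> i" "i < j" "i + j \<le> D + 2" for i j
  proof -
    have "wt_part D c i j = wt_cob \<nu> D (\<lambda>j. bval ?b j (D + 1 - j)) i j"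
      unfolding c_def using that by (intro wt_part_delta1 b) auto
    also have "\<dots> = wt_cob \<nu> D (\<lambda>j. opval (0 # cs) 1 (real j) (real (D + 1 - j))) i j"
      using that len by (auto simp: wt_cob_def bval_wt_op)
    finally show ?thesis using cob[OF that] by (simp add: wt_part_def)
  qed
  have sk: "cval c j i k = - cval c i j k" for i j k by (rule cval_skew[OF c])
  have c0: "cval c 0 j k = 0" for j k using c1 by (simp add: cval_def)
  have "cval c i j k = 0" for i j k
  proof (cases "i = 0 \<or> j = 0")
    case True
    then show ?thesis using c0[of j k] c0[of i k] sk[of 0 i k] by auto
  next
    case False
    then have ij: "1 \<le> i" "1 \<le> j" by auto
    show ?thesis
    proof (cases "i + j + k = D + 2")
      case True
      then have k: "k = D + 2 - i - j" "k = D + 2 - j - i" and "i + j \<le> D + 2" by auto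
      then show ?thesis
        using lt[of i j] lt[of j i] ij sk[of i i k] sk[of j i k]
        by (cases i j rule: linorder_cases) auto
    next
      case False
      then show ?thesis
        unfolding c_def cval_delta1[OF b ij] bval_wt_op using ij len by auto
    qed
  qed
  then have "c X Y f = 0" for X Y f
    by (intro eq_0_if_cval_eq_0[OF cocycles2D(1)[OF c]] cocycle_translation_invariant[OF c c1])
  then have "c = 0" by (simp add: fun_eq_iff)
  then show ?thesis using b by (simp add: cocycles1_def c_def)
qed

text \<open>By the length condition the derivatives of the two operators have total order d + 2, the
  total degree of the three monomials, so the composite is a constant. For i >=
  \<open>length cs\<close> the inner operator differentiates its monomials to 0.\<close>

lemma wt_part_cup:
  assumes "length cs + length ds = d + 4" "1 \<le> i" "1 \<le> j" "i + j \<le> d + 2"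
  defines "k \<equiv> d + 2 - i - j"
  shows "wt_part d (cup (wt_op cs) (wt_op ds)) i j =
    (if i < length cs then opval ds 1 (real j) (real k) * opval cs 1 (real i) (real (length cs - 1 - i)) else 0)
    - (if j < length cs then opval ds 1 (real i) (real k) * opval cs 1 (real j) (real (length cs - 1 - j)) else 0)"
proof -
  have *: "poly (wt_op cs (xpow i) (wt_op ds (xpow j) (xpow k))) 0 =
    (if i < length cs then opval ds 1 (real j) (real k) * opval cs 1 (real i) (real (length cs - 1 - i)) else 0)"
    if "i + j + k = d + 2" for i j
  proof (cases "i < length cs")
    case True
    \<comment> \<open>The degree left after the inner operator.\<close>
    define e where "e = length cs - 1 - i"
    have e: "length ds \<le> j + k + 1" "j + k + 1 - length ds = e" "length cs = i + e + 1"
      using that True assms(1) by (auto simp: e_def)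
    have "wt_op ds (xpow j) (xpow k) = smult (opval ds 1 (real j) (real k)) (xpow e)"
      using e(1,2) by (simp add: wt_op_monom smult_monom)
    then have "poly (wt_op cs (xpow i) (wt_op ds (xpow j) (xpow k))) 0
        = opval ds 1 (real j) (real k) * bval (wt_op cs) i e"
      by (simp add: wt_op_smult bval_def)
    also have "bval (wt_op cs) i e = opval cs 1 (real i) (real e)"
      using e(3) unfolding bval_wt_op by simp
    finally show ?thesis using True by (simp add: e_def)
  next
    case False
    then have "\<not> length ds \<le> j + k + 1" using that assms(1) by auto
    moreover have "wt_op cs (xpow i) 0 = 0" using wt_op_smult[of cs "xpow i" 0 0] by simp
    ultimately show ?thesis using False by (simp add: wt_op_monom)
  qed
  show ?thesis
    unfolding wt_part_def cval_def cup_def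
    using *[of i j] *[of j i] assms(2-4) by (simp add: k_def)
qed


section \<open>The given 1-cocycles as coefficient lists\<close>

lemma smult_numeral: "smult (numeral n) p = numeral n * p"
  by (simp add: numeral_poly)

lemma C3_eq: "C3 l = wt_op [0, 0, 1, 1, 0]"
  by (intro ext) (simp add: C3_def eval_nat_numeral)

lemma C4_eq: "C4 l = wt_op [0, 0, - 4, - 6, 1, - l]"
  by (intro ext) (simp add: C4_def eval_nat_numeral(2,3) smult_numeral)

lemma C_0_5_eq: "C_0_5 = wt_op [0, 0, 5, 10, - 5, 2, 0]"
  by (intro ext) (simp add: C_0_5_def eval_nat_numeral(2,3) smult_numeral)

lemma C_m4_1_eq: "C_m4_1 = wt_op [0, 0, - 5, - 10, 5, 22, 12]"
  by (intro ext) (simp add: C_m4_1_def eval_nat_numeral(2,3) smult_numeral)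

text \<open>Substituting sqrt19 = -2 a - 5 makes all coefficients affine in a, so later computations
  are polynomial in a modulo the quadratic equation of a and treat both signs of the root at
  once.\<close>

lemma C6_eq:
  assumes "a = wt_a i"
  shows "C6 i = wt_op [0, 0, 2, 5, - 5, 7 * a + 5, 7 * a + 2, (10 * a + 3) / 4]"
proof -
  have s: "sqrt19 i = - 2 * a - 5" using assms by (simp add: wt_a_def)
  have 1: "coef_alpha i = (10 * a + 3) / 4" "coef_beta i = - (7 * a + 2)" "coef_gamma i = - (7 * a + 5)"
    by (simp_all add: coef_alpha_def coef_beta_def coef_gamma_def s field_simps)
  show ?thesis
    unfolding 1[symmetric] by (intro ext) (simp add: C6_def 1 eval_nat_numeral(2,3) smult_numeral smult_add_left smult_diff_left)
qed

lemma wt_a_quadratic: "2 * (wt_a i)\<^sup>2 + 10 * wt_a i + 3 = 0"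
  by (simp add: wt_a_def sqrt19_def field_simps power2_eq_square)

lemma C3_cocycle: "C3 l \<in> cocycles1 l (l + 3)"
proof -
  have "wt_op (0 # [0, 1, 1, 0]) \<in> cocycles1 l (l + real 3)"
  proof (rule wt_op_cocycle1)
    fix i j :: nat assume *: "1 \<le> i" "i < j" "i + j \<le> 3 + 2"
    then have "i = 1 \<or> i = 2" "j = 2 \<or> j = 3 \<or> j = 4" by linarith+
    then show "wt_cob l 3 (\<lambda>j. opval [0, 0, 1, 1, 0] 1 (real j) (real (3 + 1 - j))) i j = 0"
      using * by (elim disjE) (simp_all add: wt_cob_def)
  qed simp
  then show ?thesis by (simp add: C3_eq)
qed

lemma C4_cocycle: "C4 l \<in> cocycles1 l (l + 4)"
proof -
  have "wt_op (0 # [0, - 4, - 6, 1, - l]) \<in> cocycles1 l (l + real 4)"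
  proof (rule wt_op_cocycle1)
    fix i j :: nat assume *: "1 \<le> i" "i < j" "i + j \<le> 4 + 2"
    then have "i = 1 \<or> i = 2" "j = 2 \<or> j = 3 \<or> j = 4 \<or> j = 5" by linarith+
    then show "wt_cob l 4 (\<lambda>j. opval [0, 0, - 4, - 6, 1, - l] 1 (real j) (real (4 + 1 - j))) i j = 0"
      using * by (elim disjE) (simp_all add: wt_cob_def)
  qed simp
  then show ?thesis by (simp add: C4_eq)
qed

lemma C_0_5_cocycle: "C_0_5 \<in> cocycles1 0 5"
proof -
  have "wt_op (0 # [0, 5, 10, - 5, 2, 0]) \<in> cocycles1 0 (0 + real 5)"
  proof (rule wt_op_cocycle1)
    fix i j :: nat assume *: "1 \<le> i" "i < j" "i + j \<le> 5 + 2"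
    then have "i = 1 \<or> i = 2 \<or> i = 3" "j = 2 \<or> j = 3 \<or> j = 4 \<or> j = 5 \<or> j = 6" by linarith+
    then show "wt_cob 0 5 (\<lambda>j. opval [0, 0, 5, 10, - 5, 2, 0] 1 (real j) (real (5 + 1 - j))) i j = 0"
      using * by (elim disjE) (simp_all add: wt_cob_def)
  qed simp
  then show ?thesis by (simp add: C_0_5_eq)
qed

lemma C_m4_1_cocycle: "C_m4_1 \<in> cocycles1 (- 4) 1"
proof -
  have "wt_op (0 # [0, - 5, - 10, 5, 22, 12]) \<in> cocycles1 (- 4) (- 4 + real 5)"
  proof (rule wt_op_cocycle1)
    fix i j :: nat assume *: "1 \<le> i" "i < j" "i + j \<le> 5 + 2"
    then have "i = 1 \<or> i = 2 \<or> i = 3" "j = 2 \<or> j = 3 \<or> j = 4 \<or> j = 5 \<or> j = 6" by linarith+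
    then show "wt_cob (- 4) 5 (\<lambda>j. opval [0, 0, - 5, - 10, 5, 22, 12] 1 (real j) (real (5 + 1 - j))) i j = 0"
      using * by (elim disjE) (simp_all add: wt_cob_def)
  qed simp
  then show ?thesis by (simp add: C_m4_1_eq)
qed

lemma C6_cocycle: "C6 n \<in> cocycles1 (wt_a n) (wt_a n + 6)"
proof -
  define a where "a = wt_a n"
  have a: "2 * a\<^sup>2 + 10 * a + 3 = 0" using wt_a_quadratic by (simp add: a_def)
  \<comment> \<open>The cocycle equations that do not hold identically in a, in the shape the
    simplifier reaches. Up to sign they are 1680, 20160 and 10080 times the quadratic
    equation.\<close>
  have e: "(- 1 - a * 2) * (1680 * a + 1200) - 3840 = 12720 * a"
    "- (8 * (a * (5040 * a + 1440))) = 190080 * a + 60480"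
    "- (12 * (a * (1680 * a + 1200))) = 86400 * a + 30240"
    using a by algebra+
  have "wt_op (0 # [0, 2, 5, - 5, 7 * a + 5, 7 * a + 2, (10 * a + 3) / 4]) \<in> cocycles1 a (a + real 6)"
  proof (rule wt_op_cocycle1)
    fix i j :: nat assume *: "1 \<le> i" "i < j" "i + j \<le> 6 + 2"
    then have "i = 1 \<or> i = 2 \<or> i = 3" "j = 2 \<or> j = 3 \<or> j = 4 \<or> j = 5 \<or> j = 6 \<or> j = 7" by linarith+
    then show "wt_cob a 6 (\<lambda>j. opval [0, 0, 2, 5, - 5, 7 * a + 5, 7 * a + 2, (10 * a + 3) / 4] 1 (real j) (real (6 + 1 - j))) i j = 0"
      using * by (elim disjE) (simp_all add: wt_cob_def e)
  qed simp
  then show ?thesis by (simp add: C6_eq[OF a_def] a_def)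
qed

section \<open>Evaluation of the criterion on the seven cup-products\<close>

text \<open>The cubic is -2/3 (3 nu + 7) (nu^2 + 8 nu + 9), and for d = 10 it is -1/3 (3 nu + 8) (2
  nu^2 + 18 nu + 25). The factor d - 2 + 3 nu appears because at its root the coboundary of the d-th
  derivative has entry 0 at 3 and so is a multiple of the homogeneous lift.\<close>

lemma pivot_coeff_9: "pivot_coeff \<nu> 9 = - 2 * \<nu> ^ 3 - 62 / 3 * \<nu>\<^sup>2 - 166 / 3 * \<nu> - 42"
  by (simp add: pivot_coeff_def wt_cob_def wt_lift_numerals power2_eq_square power3_eq_cube field_simps)

lemma pivot_coeff_10: "pivot_coeff \<nu> 10 = - 2 * \<nu> ^ 3 - 70 / 3 * \<nu>\<^sup>2 - 73 * \<nu> - 200 / 3"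
  by (simp add: pivot_coeff_def wt_cob_def wt_lift_numerals power2_eq_square power3_eq_cube field_simps)

lemma H2_minus8_1: "H2_spanned_by_nontrivial (- 8) 1 (cup C_m4_1 (C4 (- 8)))"
proof -
  have "H2_spanned_by_nontrivial (- 8) (- 8 + real 9) (cup C_m4_1 (C4 (- 8)))"
  proof (rule H2_spanned_by_nontrivial_criterion)
    show "cup C_m4_1 (C4 (- 8)) \<in> cocycles2 (- 8) (- 8 + real 9)"
      using cup_cocycle[OF C_m4_1_cocycle, of "C4 (- 8)" "- 8"] C4_cocycle[of "- 8"] by simp
    show "wt_functional (- 8) 9 (wt_part 9 (cup C_m4_1 (C4 (- 8)))) \<noteq> 0"
      by (simp add: wt_functional_def pivot_coeff_9 wt_cob_def wt_lift_numerals wt_part_cup C_m4_1_eq C4_eq)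
  qed (simp_all add: pivot_coeff_9)
  then show ?thesis by simp
qed

lemma H2_0_9: "H2_spanned_by_nontrivial 0 9 (cup (C4 5) C_0_5)"
proof -
  have "H2_spanned_by_nontrivial 0 (0 + real 9) (cup (C4 5) C_0_5)"
  proof (rule H2_spanned_by_nontrivial_criterion)
    show "cup (C4 5) C_0_5 \<in> cocycles2 0 (0 + real 9)"
      using cup_cocycle[OF C4_cocycle[of 5]] C_0_5_cocycle by simp
    show "wt_functional 0 9 (wt_part 9 (cup (C4 5) C_0_5)) \<noteq> 0"
      by (simp add: wt_functional_def pivot_coeff_9 wt_cob_def wt_lift_numerals wt_part_cup C_0_5_eq C4_eq)
  qed (simp_all add: pivot_coeff_9)
  then show ?thesis by simp
qed

lemma H2_minus4_5: "H2_spanned_by_nontrivial (- 4) 5 (cup (C4 1) C_m4_1)"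
proof -
  have "H2_spanned_by_nontrivial (- 4) (- 4 + real 9) (cup (C4 1) C_m4_1)"
  proof (rule H2_spanned_by_nontrivial_criterion)
    show "cup (C4 1) C_m4_1 \<in> cocycles2 (- 4) (- 4 + real 9)"
      using cup_cocycle[OF C4_cocycle[of 1]] C_m4_1_cocycle by simp
    show "wt_functional (- 4) 9 (wt_part 9 (cup (C4 1) C_m4_1)) \<noteq> 0"
      by (simp add: wt_functional_def pivot_coeff_9 wt_cob_def wt_lift_numerals wt_part_cup C_m4_1_eq C4_eq)
  qed (simp_all add: pivot_coeff_9)
  then show ?thesis by simp
qed

lemma H2_a_a_plus_9:
  assumes "a = wt_a i"
  shows "H2_spanned_by_nontrivial a (a + 9) (cup (C3 (a + 6)) (C6 i))"
proof -
  have a: "2 * a\<^sup>2 + 10 * a + 3 = 0" using wt_a_quadratic assms by simp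
  have "H2_spanned_by_nontrivial a (a + real 9) (cup (C3 (a + 6)) (C6 i))"
  proof (rule H2_spanned_by_nontrivial_criterion)
    have "cup (C3 (a + 6)) (C6 i) \<in> cocycles2 a (a + 6 + 3)"
      by (rule cup_cocycle[OF C3_cocycle C6_cocycle[of i, folded assms]])
    then show "cup (C3 (a + 6)) (C6 i) \<in> cocycles2 a (a + real 9)" by (simp add: add.commute)
    \<comment> \<open>The cubic has no root in common with the quadratic equation of a, so no
      estimate of the square root is involved.\<close>
    show "pivot_coeff a 9 \<noteq> 0" unfolding pivot_coeff_9 using a by algebra
    show "real 9 - 2 + 3 * a \<noteq> 0" using a by simp algebra
    \<comment> \<open>The value of the functional is a polynomial in a; it is nonzero because it
      shares no root with the quadratic equation.\<close>
    show "wt_functional a 9 (wt_part 9 (cup (C3 (a + 6)) (C6 i))) \<noteq> 0"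
      by (simp add: wt_functional_def pivot_coeff_9 wt_cob_def wt_lift_numerals wt_part_cup C6_eq[OF assms] C3_eq)
        (use a in algebra)
  qed simp_all
  then show ?thesis by simp
qed

lemma H2_a_minus_3_a_plus_6:
  assumes "a = wt_a i"
  shows "H2_spanned_by_nontrivial (a - 3) (a + 6) (cup (C6 i) (C3 (a - 3)))"
proof -
  have a: "2 * a\<^sup>2 + 10 * a + 3 = 0" using wt_a_quadratic assms by simp
  have "H2_spanned_by_nontrivial (a - 3) ((a - 3) + real 9) (cup (C6 i) (C3 (a - 3)))"
  proof (rule H2_spanned_by_nontrivial_criterion)
    have "cup (C6 i) (C3 (a - 3)) \<in> cocycles2 (a - 3) (a + 6)"
      by (rule cup_cocycle[OF C6_cocycle[of i, folded assms]], use C3_cocycle[of "a - 3"] in simp)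
    then show "cup (C6 i) (C3 (a - 3)) \<in> cocycles2 (a - 3) ((a - 3) + real 9)" by (simp add: add.commute)
    show "pivot_coeff (a - 3) 9 \<noteq> 0" unfolding pivot_coeff_9 using a by algebra
    show "real 9 - 2 + 3 * (a - 3) \<noteq> 0" using a by simp algebra
    show "wt_functional (a - 3) 9 (wt_part 9 (cup (C6 i) (C3 (a - 3)))) \<noteq> 0"
      by (simp add: wt_functional_def pivot_coeff_9 wt_cob_def wt_lift_numerals wt_part_cup C6_eq[OF assms] C3_eq)
        (use a in algebra)
  qed simp_all
  then show ?thesis by (simp add: add.commute)
qed

lemma H2_a_a_plus_10:
  assumes "a = wt_a i"
  shows "H2_spanned_by_nontrivial a (a + 10) (cup (C4 (a + 6)) (C6 i))"
proof -
  have a: "2 * a\<^sup>2 + 10 * a + 3 = 0" using wt_a_quadratic assms by simp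
  have "H2_spanned_by_nontrivial a (a + real 10) (cup (C4 (a + 6)) (C6 i))"
  proof (rule H2_spanned_by_nontrivial_criterion)
    have "cup (C4 (a + 6)) (C6 i) \<in> cocycles2 a (a + 6 + 4)"
      by (rule cup_cocycle[OF C4_cocycle C6_cocycle[of i, folded assms]])
    then show "cup (C4 (a + 6)) (C6 i) \<in> cocycles2 a (a + real 10)" by (simp add: add.commute)
    show "pivot_coeff a 10 \<noteq> 0" unfolding pivot_coeff_10 using a by algebra
    show "real 10 - 2 + 3 * a \<noteq> 0" using a by simp algebra
    show "wt_functional a 10 (wt_part 10 (cup (C4 (a + 6)) (C6 i))) \<noteq> 0"
      by (simp add: wt_functional_def pivot_coeff_10 wt_cob_def wt_lift_numerals wt_part_cup C6_eq[OF assms] C4_eq)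
        (use a in algebra)
  qed simp_all
  then show ?thesis by (simp add: add.commute)
qed

lemma H2_a_minus_4_a_plus_6:
  assumes "a = wt_a i"
  shows "H2_spanned_by_nontrivial (a - 4) (a + 6) (cup (C6 i) (C4 (a - 4)))"
proof -
  have a: "2 * a\<^sup>2 + 10 * a + 3 = 0" using wt_a_quadratic assms by simp
  have "H2_spanned_by_nontrivial (a - 4) ((a - 4) + real 10) (cup (C6 i) (C4 (a - 4)))"
  proof (rule H2_spanned_by_nontrivial_criterion)
    have "cup (C6 i) (C4 (a - 4)) \<in> cocycles2 (a - 4) (a + 6)"
      by (rule cup_cocycle[OF C6_cocycle[of i, folded assms]], use C4_cocycle[of "a - 4"] in simp)
    then show "cup (C6 i) (C4 (a - 4)) \<in> cocycles2 (a - 4) ((a - 4) + real 10)" by (simp add: add.commute)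
    show "pivot_coeff (a - 4) 10 \<noteq> 0" unfolding pivot_coeff_10 using a by algebra
    show "real 10 - 2 + 3 * (a - 4) \<noteq> 0" using a by simp algebra
    show "wt_functional (a - 4) 10 (wt_part 10 (cup (C6 i) (C4 (a - 4)))) \<noteq> 0"
      by (simp add: wt_functional_def pivot_coeff_10 wt_cob_def wt_lift_numerals wt_part_cup C6_eq[OF assms] C4_eq)
        (use a in algebra)
  qed simp_all
  then show ?thesis by (simp add: add.commute)
qed


theorem proposition2p8:
  fixes i :: nat
  assumes "i \<in> {1, 2}"
  shows "H2_spanned_by_nontrivial (wt_a i) (wt_a i + 9) (cup (C3 (wt_a i + 6)) (C6 i))
    \<and> H2_spanned_by_nontrivial (wt_a i - 3) (wt_a i + 6) (cup (C6 i) (C3 (wt_a i - 3)))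
    \<and> H2_spanned_by_nontrivial (- 8) 1 (cup C_m4_1 (C4 (- 8)))
    \<and> H2_spanned_by_nontrivial 0 9 (cup (C4 5) C_0_5)
    \<and> H2_spanned_by_nontrivial (- 4) 5 (cup (C4 1) C_m4_1)
    \<and> H2_spanned_by_nontrivial (wt_a i) (wt_a i + 10) (cup (C4 (wt_a i + 6)) (C6 i))
    \<and> H2_spanned_by_nontrivial (wt_a i - 4) (wt_a i + 6) (cup (C6 i) (C4 (wt_a i - 4)))"
  using H2_a_a_plus_9[OF refl] H2_a_minus_3_a_plus_6[OF refl] H2_minus8_1 H2_0_9 H2_minus4_5 H2_a_a_plus_10[OF refl] H2_a_minus_4_a_plus_6[OF refl]
  by blast

end
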